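(* Consider a body with an internal rotor and an internal mass that moves reciprocally along a straight segment fixed in the body, $\xi=k_1\sin s$, $\eta=k_2\sin s$, where $k_1,k_2$ are constants that do not vanish simultaneously, in an ideal fluid with constant circulation $\Gamma$ that may be zero or nonzero, as described in the context. Then, for a given initial velocity, the body can be moved by means of reciprocating motions of the internal mass and by rotating the internal rotor from any initial position to any final position, with any initial and final positions of the internal mass. Precisely: for all values of the constants $p_x,p_y,K$ (determined by the initial state and velocities) and all $z_0,z_1$ in the extended space of variables $z=(x,y,\alpha,s)$, there exist $T\ge 0$ and controls $\dot s=\sigma_1(t)$, $\Omega=\Omega(t)$ on $[0,T]$ such that the solution of $$\dot z=V_0(z)+V_1(z)\,\sigma_1(t)+V_2(z)\,\Omega(t),\qquad z(0)=z_0,$$ satisfies $z(T)=z_1$, where $$V_0=R\begin{pmatrix}\bar x\cos\alpha+\bar y\sin\alpha+\chi\\ -\bar x\sin\alpha+\bar y\cos\alpha+\zeta\\ K-\frac{\lambda}{2}(x^2+y^2)-xp_y+yp_x\\ 0\end{pmatrix},\quad V_1=R\begin{pmatrix}-m\frac{d\xi}{ds}\\ -m\frac{d\eta}{ds}\\ m\left(\eta\frac{d\xi}{ds}-\xi\frac{d\eta}{ds}\right)\\ 1\end{pmatrix},\quad V_2=R\begin{pmatrix}0\\ 0\\ -I_r\\ 0\end{pmatrix},\quad R=\begin{pmatrix}QA^{-1}&0\\ 0&1\end{pmatrix}.$$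
   Context: Model: a two-dimensional hydrodynamically asymmetric rigid body (mass $M$, central moment of inertia $I$) moves in an unbounded ideal incompressible fluid. It carries a point mass $m$ at the point $(\xi,\eta)$ in the body frame, inside the body, and a homogeneous circular rotor of mass $m_r$ and central moment of inertia $I_r$, rotating relative to the body with angular velocity $\Omega(t)$. The body frame $O_1\xi\eta$ has its origin $O_1$ at the center of mass of the body--rotor system; $(\xi_b,\eta_b)$ and $(\xi_r,\eta_r)$ are the body-frame positions of the centers of mass of the body and of the rotor, so $M\xi_b+m_r\xi_r=0$, $M\eta_b+m_r\eta_r=0$. The added masses are $\lambda_1\ne\lambda_2$ and the added moment of inertia is $\lambda_6$. The circulation $\Gamma$ around the body is constant; $\lambda=\rho_f\Gamma$, $\zeta=\rho_f\Gamma\mu$, $\chi=\rho_f\Gamma\nu$, where $\rho_f>0$ is the fluid density and $\mu,\nu$ are constants describing the hydrodynamical asymmetry of the body. The position is $q=(x,y,\alpha)\in\mathbb{R}^2\times\mathbb{S}^1$, where $(x,y)$ are the coordinates of $O_1$ in the fixed frame and $\alpha$ is the rotation angle of the body frame. The velocity is $w=(v_1,v_2,\omega)$, where $(v_1,v_2)$ is the velocity of $O_1$ in body axes and $\omega$ is the angular velocity, and $\dot q=Qw$ with $$Q=\begin{pmatrix}\cos\alpha&-\sin\alpha&0\\ \sin\alpha&\cos\alpha&0\\ 0&0&1\end{pmatrix},\quad A=\begin{pmatrix}a_1&0&f\\ 0&a_2&g\\ f&g&b\end{pmatrix},$$ $a_i=M+m+m_r+\lambda_i$ $(i=1,2)$,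 $f=-m\eta$, $g=m\xi$, $b=M(\xi_b^2+\eta_b^2)+I+m(\xi^2+\eta^2)+m_r(\xi_r^2+\eta_r^2)+I_r+\lambda_6$ (so $A$ depends on $s$ through $\xi(s),\eta(s)$). The controlled motion preserves the first integrals $$p_x=(a_1v_1+f\omega+m\dot\xi-\chi)\cos\alpha-(a_2v_2+g\omega+m\dot\eta-\zeta)\sin\alpha+\lambda y,$$ $$p_y=(a_1v_1+f\omega+m\dot\xi-\chi)\sin\alpha+(a_2v_2+g\omega+m\dot\eta-\zeta)\cos\alpha-\lambda x,$$ $$K=fv_1+gv_2+b\omega+m(\xi\dot\eta-\dot\xi\eta)+I_r\Omega+\tfrac{\lambda}{2}(x^2+y^2)+xp_y-yp_x.$$ Expressing $w$ from these integrals, substituting into $\dot q=Qw$ and adjoining $s$ as a variable gives the control system in the claim, with $\bar x=p_x-\lambda y$, $\bar y=p_y+\lambda x$ and $p_x,p_y,K$ constants. The variable $s$ is an angular parameter, $z=(x,y,\alpha,s)\in\mathbb{R}^2\times\mathbb{S}^1\times\mathbb{S}^1$. The controls are $\dot s$ and $\Omega$; admissible controls are piecewise continuous real functions of time, with no a priori bound on their size. *)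

theory Defs
  imports "HOL-Analysis.Analysis"
begin

record swimmer =
  body_mass :: real            (* M *)
  body_inertia :: real         (* I, about the centre of mass of the body *)
  point_mass :: real           (* m *)
  rotor_mass :: real           (* m_r *)
  rotor_inertia :: real        (* I_r, about the centre of mass of the rotor *)
  xi_body :: real
  eta_body :: real
  xi_rotor :: real
  eta_rotor :: real
  added_mass1 :: real          (* lambda_1 *)
  added_mass2 :: real          (* lambda_2 *)
  added_inertia :: real        (* lambda_6 *)
  fluid_density :: real        (* rho_f *)
  circulation :: real          (* Gamma *)
  asymmetry_mu :: real
  asymmetry_nu :: real

text \<open>
  The added masses and the added moment of inertia come from a kinetic energy of the fluid,
  hence they are nonnegative; zero is allowed (a flat plate has a vanishing added mass).
  The two equations place the origin of the body frame at the centre of mass of the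
  body--rotor system. The circulation is an arbitrary real number.
\<close>

definition admissible_swimmer :: "swimmer \<Rightarrow> bool" where
  "admissible_swimmer B \<longleftrightarrow>
     body_mass B > 0 \<and> body_inertia B > 0 \<and> point_mass B > 0 \<and>
     rotor_mass B > 0 \<and> rotor_inertia B > 0 \<and> fluid_density B > 0 \<and>
     added_mass1 B \<ge> 0 \<and> added_mass2 B \<ge> 0 \<and> added_inertia B \<ge> 0 \<and>
     added_mass1 B \<noteq> added_mass2 B \<and>
     body_mass B * xi_body B + rotor_mass B * xi_rotor B = 0 \<and>
     body_mass B * eta_body B + rotor_mass B * eta_rotor B = 0"

definition lambda :: "swimmer \<Rightarrow> real" where
  "lambda B = fluid_density B * circulation B"

definition zeta :: "swimmer \<Rightarrow> real" where
  "zeta B = fluid_density B * circulation B * asymmetry_mu B"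

definition chi :: "swimmer \<Rightarrow> real" where
  "chi B = fluid_density B * circulation B * asymmetry_nu B"

definition rotation_matrix :: "real \<Rightarrow> real^3^3" where
  "rotation_matrix \<alpha> = vector
     [vector [cos \<alpha>, - sin \<alpha>, 0],
      vector [sin \<alpha>,   cos \<alpha>, 0],
      vector [0, 0, 1]]"

definition inertia_matrix :: "swimmer \<Rightarrow> real \<Rightarrow> real \<Rightarrow> real^3^3" where
  "inertia_matrix B \<xi> \<eta> =
     (let M = body_mass B; m = point_mass B; m\<^sub>r = rotor_mass B;
          a\<^sub>1 = M + m + m\<^sub>r + added_mass1 B;
          a\<^sub>2 = M + m + m\<^sub>r + added_mass2 B;
          f = - m * \<eta>;
          g = m * \<xi>;
          b = M * ((xi_body B)\<^sup>2 + (eta_body B)\<^sup>2) + body_inertia B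
              + m * (\<xi>\<^sup>2 + \<eta>\<^sup>2)
              + m\<^sub>r * ((xi_rotor B)\<^sup>2 + (eta_rotor B)\<^sup>2) + rotor_inertia B
              + added_inertia B
      in vector [vector [a\<^sub>1, 0, f], vector [0, a\<^sub>2, g], vector [f, g, b]])"

definition R_matrix :: "swimmer \<Rightarrow> real \<Rightarrow> real \<Rightarrow> real \<Rightarrow> real^4^4" where
  "R_matrix B \<xi> \<eta> \<alpha> =
     (let N = rotation_matrix \<alpha> ** matrix_inv (inertia_matrix B \<xi> \<eta>)
      in vector
          [vector [N$1$1, N$1$2, N$1$3, 0],
           vector [N$2$1, N$2$2, N$2$3, 0],
           vector [N$3$1, N$3$2, N$3$3, 0],
           vector [0, 0, 0, 1]])"

text \<open>
  The vector fields are written in the coordinates \<open>z = (x, y, \<alpha>, s)\<close> with real angles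
  \<open>\<alpha>\<close>, \<open>s\<close>, for an internal mass moving along \<open>s \<mapsto> (\<xi> s, \<eta> s)\<close>.
\<close>

definition V0 ::
    "swimmer \<Rightarrow> (real \<Rightarrow> real) \<Rightarrow> (real \<Rightarrow> real) \<Rightarrow> real \<Rightarrow> real \<Rightarrow> real \<Rightarrow> real^4 \<Rightarrow> real^4" where
  "V0 B \<xi> \<eta> p\<^sub>x p\<^sub>y K z =
     (let x = z$1; y = z$2; \<alpha> = z$3; s = z$4;
          xbar = p\<^sub>x - lambda B * y;
          ybar = p\<^sub>y + lambda B * x
      in R_matrix B (\<xi> s) (\<eta> s) \<alpha> *v vector
          [xbar * cos \<alpha> + ybar * sin \<alpha> + chi B,
           - xbar * sin \<alpha> + ybar * cos \<alpha> + zeta B,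
           K - lambda B / 2 * (x\<^sup>2 + y\<^sup>2) - x * p\<^sub>y + y * p\<^sub>x,
           0])"

definition V1 ::
    "swimmer \<Rightarrow> (real \<Rightarrow> real) \<Rightarrow> (real \<Rightarrow> real) \<Rightarrow> real^4 \<Rightarrow> real^4" where
  "V1 B \<xi> \<eta> z =
     (let \<alpha> = z$3; s = z$4; m = point_mass B
      in R_matrix B (\<xi> s) (\<eta> s) \<alpha> *v vector
          [- m * deriv \<xi> s,
           - m * deriv \<eta> s,
           m * (\<eta> s * deriv \<xi> s - \<xi> s * deriv \<eta> s),
           1])"

definition V2 ::
    "swimmer \<Rightarrow> (real \<Rightarrow> real) \<Rightarrow> (real \<Rightarrow> real) \<Rightarrow> real^4 \<Rightarrow> real^4" where
  "V2 B \<xi> \<eta> z =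
     (let \<alpha> = z$3; s = z$4
      in R_matrix B (\<xi> s) (\<eta> s) \<alpha> *v vector [0, 0, - rotor_inertia B, 0])"

definition piecewise_continuous_on :: "real \<Rightarrow> real \<Rightarrow> (real \<Rightarrow> real) \<Rightarrow> bool" where
  "piecewise_continuous_on a b u \<longleftrightarrow>
     (\<exists>S. finite S \<and> continuous_on ({a..b} - S) u) \<and>
     (\<forall>t\<in>{a<..b}. \<exists>l. (u \<longlongrightarrow> l) (at_left t)) \<and>
     (\<forall>t\<in>{a..<b}. \<exists>l. (u \<longlongrightarrow> l) (at_right t))"

text \<open>
  Solutions for piecewise continuous controls are continuous and satisfy the differential
  equation outside a finite set of times (where the controls may jump).
\<close>

definition is_solution ::
    "swimmer \<Rightarrow> (real \<Rightarrow> real) \<Rightarrow> (real \<Rightarrow> real) \<Rightarrow> real \<Rightarrow> real \<Rightarrow> real \<Rightarrow> real \<Rightarrow>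
     (real \<Rightarrow> real) \<Rightarrow> (real \<Rightarrow> real) \<Rightarrow> (real \<Rightarrow> real^4) \<Rightarrow> bool" where
  "is_solution B \<xi> \<eta> p\<^sub>x p\<^sub>y K T \<sigma>\<^sub>1 \<Omega> z \<longleftrightarrow>
     continuous_on {0..T} z \<and>
     (\<exists>S. finite S \<and>
        (\<forall>t\<in>{0..T} - S.
           (z has_vector_derivative
              V0 B \<xi> \<eta> p\<^sub>x p\<^sub>y K (z t) + \<sigma>\<^sub>1 t *\<^sub>R V1 B \<xi> \<eta> (z t) + \<Omega> t *\<^sub>R V2 B \<xi> \<eta> (z t))
           (at t within {0..T})))"

text \<open>
  Points of the extended space have unit complex numbers as angular components. If \<open>\<xi>\<close> and
  \<open>\<eta>\<close> have period \<open>2\<pi>\<close>, the vector fields above have period \<open>2\<pi>\<close> in \<open>\<alpha>\<close> and \<open>s\<close>, so the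
  solutions in the extended space are exactly the images of the solutions in real
  coordinates under \<open>extended_point\<close>, whichever real angles are chosen at the initial time.
\<close>

definition extended_space :: "(real \<times> real \<times> complex \<times> complex) set" where
  "extended_space = UNIV \<times> UNIV \<times> sphere 0 1 \<times> sphere 0 1"

definition extended_point :: "real^4 \<Rightarrow> real \<times> real \<times> complex \<times> complex" where
  "extended_point z = (z$1, z$2, cis (z$3), cis (z$4))"

end

theory Submission
  imports Defs
begin

text \<open>
  Write \<open>p = x + i y\<close>, \<open>u = sin s\<close> and \<open>k = k\<^sub>1 + i k\<^sub>2\<close>. The rotor speed enters only the third row of the
  equations of motion and can absorb any prescribed angular velocity, so \<open>\<alpha>\<close> and \<open>s\<close> may be
  chosen freely and \<open>p\<close> then solves a linear equation whose drift is bounded independently of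
  the chosen path. The remaining part of the velocity depends linearly on \<open>u\<close> and its derivative.
  During one full turn of the body in a short time \<open>T\<close> with \<open>u = Re (r (1 - exp (i \<alpha>)))\<close> the body is
  displaced by \<open>c * cnj r + O(T)\<close>, where \<open>c\<close> is a nonzero multiple of \<open>(1/a\<^sub>1 - 1/a\<^sub>2) * cnj k\<close>. By superposition
  the displacement is an exactly affine function of \<open>r\<close>, so for small \<open>T\<close> a suitable small \<open>r\<close>
  realises every displacement up to a size that does not depend on the starting point.
  Connectedness of the plane then joins all positions with \<open>\<alpha> = s = 0\<close>, and arbitrary
  configurations are joined to these by prescribing \<open>p\<close> at the start or at the end of a path.
\<close>

section \<open>Differential equations on short intervals\<close>

lemma vector_mean_value_bound:
  fixes f :: "real \<Rightarrow> 'a::real_normed_vector"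
  assumes "\<And>t. t \<in> {a..b} \<Longrightarrow> (f has_vector_derivative f' t) (at t within {a..b})"
    and "\<And>t. t \<in> {a..b} \<Longrightarrow> norm (f' t) \<le> C"
    and "x \<in> {a..b}" "y \<in> {a..b}"
  shows "norm (f y - f x) \<le> C * \<bar>y - x\<bar>"
proof -
  have "norm (f y - f x) \<le> C * norm (y - x)"
  proof (rule differentiable_bound [of "{a..b}" f "\<lambda>t h. h *\<^sub>R f' t"])
    fix t assume t: "t \<in> {a..b}"
    show "(f has_derivative (\<lambda>h. h *\<^sub>R f' t)) (at t within {a..b})"
      using assms(1)[OF t] by (simp add: has_vector_derivative_def)
    show "onorm (\<lambda>h. h *\<^sub>R f' t) \<le> C"
      using assms(2)[OF t] by (intro onorm_le) (metis abs_ge_zero mult.commute mult_right_mono norm_scaleR real_norm_def)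
  qed (use assms in auto)
  then show ?thesis by simp
qed

text \<open>The Picard operator contracts the sup norm because the Lipschitz constant times the
  length \<open>T\<close> is below 1. The value may be given at any time \<open>t0\<close>, so that
  a position can be prescribed at the end of a motion as well as at its start.\<close>

lemma picard_lindelof_short_time:
  fixes F :: "real \<Rightarrow> 'a::banach \<Rightarrow> 'a"
  assumes t0: "t0 \<in> {0..T}"
    and cont: "continuous_on ({0..T} \<times> UNIV) (\<lambda>(t, x). F t x)"
    and lip: "\<And>t x y. t \<in> {0..T} \<Longrightarrow> norm (F t x - F t y) \<le> C * norm (x - y)"
    and C: "0 \<le> C" "C * T < 1"
  obtains p where "p t0 = p0"
    and "\<And>t. t \<in> {0..T} \<Longrightarrow> (p has_vector_derivative F t (p t)) (at t within {0..T})"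
proof -
  \<comment> \<open>Clamping time to \<open>{0..T}\<close> extends each candidate to a bounded
    continuous function on the whole line, so the fixed point theorem applies in the complete space
    of such functions.\<close>
  define cl where "cl = (\<lambda>t. max 0 (min T t))"
  have T: "0 \<le> T" using t0 by auto
  have cl_in: "cl t \<in> {0..T}" for t using T by (auto simp: cl_def)
  have cl_id: "cl t = t" if "t \<in> {0..T}" for t using that by (auto simp: cl_def)
  define J where "J = (\<lambda>f t. integral {0..t} (\<lambda>s. F s (f s)))"
  have deriv: "(J f has_vector_derivative F t (f t)) (at t within {0..T})"
    if "continuous_on {0..T} f" "t \<in> {0..T}" for f t
  proof -
    have "continuous_on {0..T} (\<lambda>s. case (s, f s) of (t, x) \<Rightarrow> F t x)"
      by (rule continuous_on_compose2[OF cont]) (auto intro!: continuous_intros that)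
    then show ?thesis
      unfolding J_def using that(2) by (intro integral_has_vector_derivative) auto
  qed
  have contJ: "continuous_on {0..T} (J f)" if "continuous_on {0..T} f" for f
    using deriv[OF that] by (rule continuous_on_vector_derivative)
  define \<Phi> :: "(real \<Rightarrow>\<^sub>C 'a) \<Rightarrow> (real \<Rightarrow>\<^sub>C 'a)" where
    "\<Phi> = (\<lambda>f. Bcontfun (\<lambda>t. p0 + (J (apply_bcontfun f) (cl t) - J (apply_bcontfun f) t0)))"
  have contf: "continuous_on S (apply_bcontfun f)" for f :: "real \<Rightarrow>\<^sub>C 'a" and S
    by (intro continuous_on_apply_bcontfun)
  have app: "apply_bcontfun (\<Phi> f) = (\<lambda>t. p0 + (J (apply_bcontfun f) (cl t) - J (apply_bcontfun f) t0))" for f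
  proof -
    let ?g = "\<lambda>t. p0 + (J (apply_bcontfun f) t - J (apply_bcontfun f) t0)"
    have g: "continuous_on {0..T} ?g" by (intro continuous_intros contJ contf)
    have "continuous_on UNIV (\<lambda>t. ?g (cl t))"
      by (rule continuous_on_compose2[OF g]) (use cl_in in \<open>auto simp: cl_def intro!: continuous_intros\<close>)
    moreover have "bounded (range (\<lambda>t. ?g (cl t)))"
      by (rule bounded_subset[OF compact_imp_bounded[OF compact_continuous_image[OF g]]])
         (use cl_in in auto)
    ultimately have "(\<lambda>t. ?g (cl t)) \<in> bcontfun" by (simp add: bcontfun_def)
    then show ?thesis by (simp add: \<Phi>_def Bcontfun_inverse)
  qed
  have "\<exists>!f. \<Phi> f = f"
  proof (rule banach_fix_type[of "C * T"], use C T in simp, use C in simp, intro allI, rule dist_bound)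
    fix f g :: "real \<Rightarrow>\<^sub>C 'a" and t
    let ?H = "\<lambda>t. J (apply_bcontfun f) t - J (apply_bcontfun g) t"
    have "norm (?H (cl t) - ?H t0) \<le> (C * dist f g) * \<bar>cl t - t0\<bar>"
    proof (rule vector_mean_value_bound[of 0 T])
      fix s assume s: "s \<in> {0..T}"
      show "(?H has_vector_derivative F s (f s) - F s (g s)) (at s within {0..T})"
        by (intro derivative_intros deriv contf s)
      show "norm (F s (f s) - F s (g s)) \<le> C * dist f g"
        using lip[OF s, of "f s" "g s"] dist_bounded[of f s g] C(1)
        by (smt (verit) dist_norm mult_left_mono)
    qed (use cl_in t0 in auto)
    also have "\<dots> \<le> (C * dist f g) * T"
      using cl_in[of t] t0 C by (intro mult_left_mono) auto
    finally show "dist (\<Phi> f t) (\<Phi> g t) \<le> C * T * dist f g"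
      by (simp add: app dist_norm algebra_simps)
  qed
  then obtain f where f: "\<Phi> f = f" by auto
  have feq: "apply_bcontfun f t = p0 + (J (apply_bcontfun f) (cl t) - J (apply_bcontfun f) t0)" for t
    using fun_cong[OF app[of f], of t] unfolding f .
  show thesis
  proof
    show "f t0 = p0" using feq[of t0] cl_id[OF t0] by simp
    fix t assume t: "t \<in> {0..T}"
    have "((\<lambda>t. p0 + (J (apply_bcontfun f) t - J (apply_bcontfun f) t0)) has_vector_derivative F t (f t))
            (at t within {0..T})"
      by (auto intro!: derivative_eq_intros deriv contf t)
    then show "(f has_vector_derivative F t (f t)) (at t within {0..T})"
      by (rule has_vector_derivative_transform[OF t, rotated]) (subst feq, simp add: cl_id)
  qed
qed

text \<open>At a time \<open>m\<close> where \<open>norm (p t)\<close> is largest, the mean value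
  bound gives \<open>norm (p m) \<le> norm (p 0) + norm (p m) / 2 + T * E\<close>, and the middle
  term is absorbed on the left. On short intervals this does the work of a Gronwall
  estimate.\<close>

lemma linear_ode_bound:
  fixes p :: "real \<Rightarrow> 'a::real_normed_vector"
  assumes p: "\<And>t. t \<in> {0..T} \<Longrightarrow> (p has_vector_derivative A t (p t) + e t) (at t within {0..T})"
    and A: "\<And>t x. t \<in> {0..T} \<Longrightarrow> norm (A t x) \<le> C * norm x"
    and e: "\<And>t. t \<in> {0..T} \<Longrightarrow> norm (e t) \<le> E"
    and C: "0 \<le> C" "C * T \<le> 1 / 2" and t: "t \<in> {0..T}"
  shows "norm (p t) \<le> 2 * (norm (p 0) + T * E)"
proof -
  have "continuous_on {0..T} p" using p by (rule continuous_on_vector_derivative)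
  then obtain m where m: "m \<in> {0..T}" "\<And>s. s \<in> {0..T} \<Longrightarrow> norm (p s) \<le> norm (p m)"
    using continuous_attains_sup[of "{0..T}" "\<lambda>s. norm (p s)"] t
    by (force intro!: continuous_intros)
  have E: "0 \<le> C * norm (p m) + E"
    using e[OF t] C by (smt (verit) mult_nonneg_nonneg norm_ge_zero)
  have "norm (p m - p 0) \<le> (C * norm (p m) + E) * \<bar>m - 0\<bar>"
  proof (rule vector_mean_value_bound[OF p])
    fix s assume s: "s \<in> {0..T}"
    have "norm (A s (p s)) \<le> C * norm (p m)"
      using A[OF s, of "p s"] m(2)[OF s] C(1) by (smt (verit) mult_left_mono)
    then show "norm (A s (p s) + e s) \<le> C * norm (p m) + E"
      using e[OF s] by (smt (verit) norm_triangle_ineq)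
  qed (use m t in auto)
  also have "\<dots> \<le> (C * norm (p m) + E) * T"
    using m E by (intro mult_left_mono) auto
  also have "\<dots> = (C * T) * norm (p m) + T * E" by (simp add: algebra_simps)
  also have "\<dots> \<le> 1/2 * norm (p m) + T * E"
    using C by (intro add_right_mono mult_right_mono) auto
  finally have "norm (p m) \<le> 2 * (norm (p 0) + T * E)"
    using norm_triangle_ineq2[of "p m" "p 0"] unfolding distrib_left by linarith
  then show ?thesis using m(2)[OF t] by linarith
qed

text \<open>The difference \<open>p - G\<close> has derivative \<open>A t (p t)\<close>, which the
  preceding bound controls. Even for \<open>E\<close> of order \<open>1 / T\<close> the error is of
  order \<open>T\<close>.\<close>

lemma linear_ode_displacement:
  fixes p :: "real \<Rightarrow> 'a::real_normed_vector"
  assumes p: "\<And>t. t \<in> {0..T} \<Longrightarrow> (p has_vector_derivative A t (p t) + e t) (at t within {0..T})"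
    and A: "\<And>t x. t \<in> {0..T} \<Longrightarrow> norm (A t x) \<le> C * norm x"
    and e: "\<And>t. t \<in> {0..T} \<Longrightarrow> norm (e t) \<le> E"
    and C: "0 \<le> C" "C * T \<le> 1 / 2" and T: "0 \<le> T"
    and G: "\<And>t. t \<in> {0..T} \<Longrightarrow> (G has_vector_derivative e t) (at t within {0..T})"
  shows "norm ((p T - p 0) - (G T - G 0)) \<le> 2 * C * T * (norm (p 0) + T * E)"
proof -
  have "norm ((p T - G T) - (p 0 - G 0)) \<le> (C * (2 * (norm (p 0) + T * E))) * \<bar>T - 0\<bar>"
  proof (rule vector_mean_value_bound[of 0 T "\<lambda>t. p t - G t" "\<lambda>t. A t (p t)"])
    fix s assume s: "s \<in> {0..T}"
    show "((\<lambda>t. p t - G t) has_vector_derivative A s (p s)) (at s within {0..T})"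
      using has_vector_derivative_diff[OF p[OF s] G[OF s]] by simp
    show "norm (A s (p s)) \<le> C * (2 * (norm (p 0) + T * E))"
      using A[OF s, of "p s"] linear_ode_bound[OF p A e C s] C(1) by (smt (verit) mult_left_mono)
  qed (use T in auto)
  then show ?thesis using T by (simp add: algebra_simps)
qed

section \<open>Piecewise continuous controls\<close>

lemma piecewise_continuous_on_shift:
  assumes "piecewise_continuous_on a b u"
  shows "piecewise_continuous_on (a + d) (b + d) (\<lambda>t. u (t - d))"
proof -
  from assms obtain S where S: "finite S" "continuous_on ({a..b} - S) u"
    by (auto simp: piecewise_continuous_on_def)
  have "continuous_on ({a + d..b + d} - (\<lambda>t. t + d) ` S) (\<lambda>t. u (t - d))"
    by (rule continuous_on_compose2[OF S(2)]) (force intro!: continuous_intros)+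
  moreover have "\<exists>l. ((\<lambda>t. u (t - d)) \<longlongrightarrow> l) (at_left t)" if "t \<in> {a + d<..b + d}" for t
  proof -
    from that have "t - d \<in> {a<..b}" by auto
    then obtain l where "(u \<longlongrightarrow> l) (at_left (t - d))"
      using assms unfolding piecewise_continuous_on_def by blast
    moreover have "at_left (t - d) = filtermap (\<lambda>x. x - d) (at_left t)"
      by (simp add: filtermap_at_left_shift)
    ultimately show ?thesis by (auto simp: filterlim_filtermap)
  qed
  moreover have "\<exists>l. ((\<lambda>t. u (t - d)) \<longlongrightarrow> l) (at_right t)" if "t \<in> {a + d..<b + d}" for t
  proof -
    from that have "t - d \<in> {a..<b}" by auto
    then obtain l where "(u \<longlongrightarrow> l) (at_right (t - d))"
      using assms unfolding piecewise_continuous_on_def by blast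
    moreover have "at_right (t - d) = filtermap (\<lambda>x. x - d) (at_right t)"
      by (simp add: filtermap_at_right_shift)
    ultimately show ?thesis by (auto simp: filterlim_filtermap)
  qed
  ultimately show ?thesis
    unfolding piecewise_continuous_on_def using S(1) by blast
qed

text \<open>The junction \<open>b\<close> joins the exceptional set; there the left limit is that of
  \<open>u\<close> and the right limit that of \<open>v\<close>.\<close>

lemma piecewise_continuous_on_join:
  assumes u: "piecewise_continuous_on a b u" and v: "piecewise_continuous_on b c v"
  shows "piecewise_continuous_on a c (\<lambda>t. if t \<le> b then u t else v t)" (is "piecewise_continuous_on a c ?w")
proof -
  from u obtain S where S: "finite S" "continuous_on ({a..b} - S) u"
    by (auto simp: piecewise_continuous_on_def)
  from v obtain S' where S': "finite S'" "continuous_on ({b..c} - S') v"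
    by (auto simp: piecewise_continuous_on_def)
  have left: "eventually (\<lambda>x. ?w x = u x) (at t within X)" if "t < b" for t X
    using that by (auto simp: eventually_at_topological intro!: exI[of _ "{..<b}"])
  have right: "eventually (\<lambda>x. ?w x = v x) (at t within X)" if "b < t" for t X
    using that by (auto simp: eventually_at_topological intro!: exI[of _ "{b<..}"])
  have "continuous_on ({a..c} - (S \<union> S' \<union> {b})) ?w"
    unfolding continuous_on_def
  proof
    fix t assume t: "t \<in> {a..c} - (S \<union> S' \<union> {b})"
    let ?X = "{a..c} - (S \<union> S' \<union> {b})"
    consider "t < b" | "b < t" using t by fastforce
    then show "(?w \<longlongrightarrow> ?w t) (at t within ?X)"
    proof cases
      case 1
      have "(u \<longlongrightarrow> u t) (at t within ({a..b} - S))"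
        using S(2) t 1 by (auto simp: continuous_on_def)
      then have "(u \<longlongrightarrow> u t) (at t within (({a..b} - S) \<inter> {..<b}))"
        by (rule tendsto_within_subset) auto
      then have "(u \<longlongrightarrow> u t) (at t within (?X \<inter> {..<b}))"
        by (rule tendsto_within_subset) auto
      then have "(u \<longlongrightarrow> u t) (at t within ?X)"
        using at_within_nhd[of t "{..<b}" "?X \<inter> {..<b}" ?X] 1 by auto
      then show ?thesis using 1 tendsto_cong[OF left[OF 1]] by simp
    next
      case 2
      have "(v \<longlongrightarrow> v t) (at t within ({b..c} - S'))"
        using S'(2) t 2 by (auto simp: continuous_on_def)
      then have "(v \<longlongrightarrow> v t) (at t within (?X \<inter> {b<..}))"
        by (rule tendsto_within_subset) auto
      then have "(v \<longlongrightarrow> v t) (at t within ?X)"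
        using at_within_nhd[of t "{b<..}" "?X \<inter> {b<..}" ?X] 2 by auto
      then show ?thesis using 2 tendsto_cong[OF right[OF 2]] by simp
    qed
  qed
  moreover have "\<exists>l. (?w \<longlongrightarrow> l) (at_left t)" if t: "t \<in> {a<..c}" for t
  proof (cases "t \<le> b")
    case True
    have ev: "eventually (\<lambda>x. ?w x = u x) (at_left t)"
      using True by (intro eventually_at_leftI[of "t - 1"]) auto
    moreover obtain l where "(u \<longlongrightarrow> l) (at_left t)"
    proof -
      have "t \<in> {a<..b}" using t True by auto
      then show thesis using u that unfolding piecewise_continuous_on_def by blast
    qed
    ultimately show ?thesis using tendsto_cong[OF ev] by auto
  next
    case False
    moreover obtain l where "(v \<longlongrightarrow> l) (at_left t)"
    proof -
      have "t \<in> {b<..c}" using t False by auto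
      then show thesis using v that unfolding piecewise_continuous_on_def by blast
    qed
    ultimately show ?thesis using tendsto_cong[OF right, of t] by auto
  qed
  moreover have "\<exists>l. (?w \<longlongrightarrow> l) (at_right t)" if t: "t \<in> {a..<c}" for t
  proof (cases "t < b")
    case True
    moreover obtain l where "(u \<longlongrightarrow> l) (at_right t)"
    proof -
      have "t \<in> {a..<b}" using t True by auto
      then show thesis using u that unfolding piecewise_continuous_on_def by blast
    qed
    ultimately show ?thesis using tendsto_cong[OF left, of t] by auto
  next
    case False
    have ev: "eventually (\<lambda>x. ?w x = v x) (at_right t)"
      using False by (intro eventually_at_rightI[of _ "t + 1"]) auto
    moreover obtain l where "(v \<longlongrightarrow> l) (at_right t)"
    proof -
      have "t \<in> {b..<c}" using t False by auto
      then show thesis using v that unfolding piecewise_continuous_on_def by blast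
    qed
    ultimately show ?thesis using tendsto_cong[OF ev] by auto
  qed
  ultimately show ?thesis
    unfolding piecewise_continuous_on_def using S(1) S'(1)
    by (intro conjI exI[of _ "S \<union> S' \<union> {b}"]) auto
qed

lemma continuous_imp_piecewise_continuous_on:
  assumes "continuous_on {a..b} u"
  shows "piecewise_continuous_on a b u"
proof -
  have 1: "continuous_on ({a..b} - {}) u" using assms by simp
  have 2: "\<exists>l. (u \<longlongrightarrow> l) (at_left t)" if t: "t \<in> {a<..b}" for t
  proof -
    have "(u \<longlongrightarrow> u t) (at t within {a..b})" using assms t by (auto simp: continuous_on_def)
    then have "(u \<longlongrightarrow> u t) (at t within {a..<t})"
      by (rule tendsto_within_subset) (use t in auto)
    moreover have "at t within {a..<t} = at_left t"
      using t by (intro at_within_nhd[of t "{a<..}"]) auto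
    ultimately show ?thesis by auto
  qed
  have 3: "\<exists>l. (u \<longlongrightarrow> l) (at_right t)" if t: "t \<in> {a..<b}" for t
  proof -
    have "(u \<longlongrightarrow> u t) (at t within {a..b})" using assms t by (auto simp: continuous_on_def)
    then have "(u \<longlongrightarrow> u t) (at t within {t<..b})"
      by (rule tendsto_within_subset) (use t in auto)
    moreover have "at t within {t<..b} = at_right t"
      using t by (intro at_within_nhd[of t "{..<b}"]) auto
    ultimately show ?thesis by auto
  qed
  show ?thesis unfolding piecewise_continuous_on_def using 1 2 3 by blast
qed

section \<open>Reduction to the shape variables\<close>

lemma vector_4 [simp]:
  "(vector [x, y, z, w] :: 'a::zero^4) $ 1 = x"
  "(vector [x, y, z, w] :: 'a::zero^4) $ 2 = y"
  "(vector [x, y, z, w] :: 'a::zero^4) $ 3 = z"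
  "(vector [x, y, z, w] :: 'a::zero^4) $ 4 = w"
  unfolding vector_def by simp_all

lemma has_vector_derivative_vector_4:
  assumes "(f has_real_derivative f') (at t within S)" "(g has_real_derivative g') (at t within S)"
    "(h has_real_derivative h') (at t within S)" "(j has_real_derivative j') (at t within S)"
  shows "((\<lambda>t. vector [f t, g t, h t, j t] :: real^4) has_vector_derivative vector [f', g', h', j'])
           (at t within S)"
proof -
  have "((\<lambda>t. (vector [f t, g t, h t, j t] :: real^4) $ i) has_vector_derivative
          (vector [f', g', h', j'] :: real^4) $ i) (at t within S)" for i
    using exhaust_4[of i] assms by (auto simp: has_real_derivative_iff_has_vector_derivative)
  then show ?thesis
    unfolding has_vector_derivative_def
    by (subst has_derivative_componentwise_within) (auto simp: Basis_vec_def inner_axis)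
qed

text \<open>Used to glue motions: two real representatives of one extended point differ by multiples
  of \<open>2 * pi\<close> in the angles, so translating a path by the difference leaves its image
  unchanged.\<close>

lemma extended_point_add_diff:
  assumes "extended_point u = extended_point v"
  shows "extended_point (w + (u - v)) = extended_point w"
proof -
  have "cis (a + (b - c)) = cis a" if "cis b = cis c" for a b c
    using that by (simp flip: cis_mult cis_divide)
  then show ?thesis using assms by (simp add: extended_point_def)
qed

lemma matrix_inv_left:
  assumes "invertible A"
  shows "matrix_inv A ** A = mat 1"
  using assms unfolding invertible_def matrix_inv_def by (rule someI2_ex) simp

text \<open>The map \<open>r \<mapsto> c * cnj r\<close> multiplies norms by \<open>norm c\<close>,
  so \<open>f\<close> is bounded below by \<open>norm c - \<epsilon>\<close>. Hence \<open>f\<close>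
  is injective, in finite dimension surjective, and the same lower bound controls the
  preimage.\<close>

lemma real_linear_near_cnj_surj:
  fixes f :: "complex \<Rightarrow> complex"
  assumes f: "linear f" and c: "\<epsilon> < norm c"
    and near: "\<And>r. norm (f r - c * cnj r) \<le> \<epsilon> * norm r"
  obtains r where "f r = y" "(norm c - \<epsilon>) * norm r \<le> norm y"
proof -
  have lower: "(norm c - \<epsilon>) * norm r \<le> norm (f r)" for r
  proof -
    have "norm c * norm r = norm (c * cnj r)" by (simp add: norm_mult)
    also have "\<dots> \<le> norm (f r) + \<epsilon> * norm r"
      using near[of r] norm_triangle_sub[of "c * cnj r" "f r"] by (simp add: norm_minus_commute)
    finally show ?thesis by (simp add: algebra_simps)
  qed
  have "inj f"
  proof (rule linear_injective_0[OF f, THEN iffD2], intro allI impI)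
    fix r assume "f r = 0"
    then have "(norm c - \<epsilon>) * norm r \<le> 0" using lower[of r] by simp
    then show "r = 0" using c by (simp add: mult_le_0_iff)
  qed
  then have "surj f" using linear_injective_imp_surjective f by blast
  then obtain r where "y = f r" by (rule surjE)
  then show thesis using that[of r] lower[of r] by simp
qed

section \<open>Inertia and vector fields for a mass on a straight segment\<close>

locale straight_swimmer =
  fixes B :: swimmer and k\<^sub>1 k\<^sub>2 p\<^sub>x p\<^sub>y K :: real
  assumes admissible: "admissible_swimmer B" and segment: "\<not> (k\<^sub>1 = 0 \<and> k\<^sub>2 = 0)"
begin

abbreviation \<xi> :: "real \<Rightarrow> real" where "\<xi> \<equiv> \<lambda>s. k\<^sub>1 * sin s"
abbreviation \<eta> :: "real \<Rightarrow> real" where "\<eta> \<equiv> \<lambda>s. k\<^sub>2 * sin s"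

abbreviation m :: real where "m \<equiv> point_mass B"

definition a\<^sub>1 :: real where "a\<^sub>1 = body_mass B + m + rotor_mass B + added_mass1 B"
definition a\<^sub>2 :: real where "a\<^sub>2 = body_mass B + m + rotor_mass B + added_mass2 B"

definition b :: "real \<Rightarrow> real \<Rightarrow> real" where
  "b x y = body_mass B * ((xi_body B)\<^sup>2 + (eta_body B)\<^sup>2) + body_inertia B
     + m * (x\<^sup>2 + y\<^sup>2) + rotor_mass B * ((xi_rotor B)\<^sup>2 + (eta_rotor B)\<^sup>2) + rotor_inertia B
     + added_inertia B"

lemma m_pos: "0 < m"
  and a\<^sub>1_gt: "m < a\<^sub>1" and a\<^sub>2_gt: "m < a\<^sub>2" and a_neq: "a\<^sub>1 \<noteq> a\<^sub>2"
  and rotor_inertia_nz: "rotor_inertia B \<noteq> 0"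
  using admissible by (auto simp: admissible_swimmer_def a\<^sub>1_def a\<^sub>2_def)

lemma b_gt: "m * (x\<^sup>2 + y\<^sup>2) < b x y"
proof -
  have "0 \<le> body_mass B * ((xi_body B)\<^sup>2 + (eta_body B)\<^sup>2)"
    "0 \<le> rotor_mass B * ((xi_rotor B)\<^sup>2 + (eta_rotor B)\<^sup>2)"
    using admissible by (auto simp: admissible_swimmer_def)
  then show ?thesis using admissible unfolding admissible_swimmer_def b_def by linarith
qed

lemma inertia_matrix_eq:
  "inertia_matrix B x y =
     vector [vector [a\<^sub>1, 0, - m * y], vector [0, a\<^sub>2, m * x], vector [- m * y, m * x, b x y]]"
  by (simp add: inertia_matrix_def Let_def a\<^sub>1_def a\<^sub>2_def b_def)

text \<open>In the determinant \<open>a\<^sub>1 * a\<^sub>2 * b - a\<^sub>1 * (m * x)\<^sup>2 -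
  a\<^sub>2 * (m * y)\<^sup>2\<close> the subtracted terms are at most
  \<open>a\<^sub>1 * a\<^sub>2 * m * (x\<^sup>2 + y\<^sup>2)\<close>, since both
  \<open>a\<^sub>1\<close> and \<open>a\<^sub>2\<close> exceed \<open>m\<close>; and
  \<open>b\<close> exceeds \<open>m * (x\<^sup>2 + y\<^sup>2)\<close>.\<close>

lemma invertible_inertia_matrix: "invertible (inertia_matrix B x y)"
proof -
  have pos: "0 < a\<^sub>1" "0 < a\<^sub>2" using m_pos a\<^sub>1_gt a\<^sub>2_gt by auto
  have "a\<^sub>1 * (m * x)\<^sup>2 = a\<^sub>1 * m * (m * x\<^sup>2)" by (simp add: power2_eq_square)
  also have "\<dots> \<le> a\<^sub>1 * a\<^sub>2 * (m * x\<^sup>2)"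
    using m_pos a\<^sub>2_gt pos by (intro mult_right_mono mult_left_mono) auto
  finally have 1: "a\<^sub>1 * (m * x)\<^sup>2 \<le> a\<^sub>1 * a\<^sub>2 * (m * x\<^sup>2)" .
  have "a\<^sub>2 * (m * y)\<^sup>2 = m * a\<^sub>2 * (m * y\<^sup>2)" by (simp add: power2_eq_square)
  also have "\<dots> \<le> a\<^sub>1 * a\<^sub>2 * (m * y\<^sup>2)"
    using m_pos a\<^sub>1_gt pos by (intro mult_right_mono) auto
  finally have 2: "a\<^sub>2 * (m * y)\<^sup>2 \<le> a\<^sub>1 * a\<^sub>2 * (m * y\<^sup>2)" .
  have "a\<^sub>1 * a\<^sub>2 * (m * (x\<^sup>2 + y\<^sup>2)) < a\<^sub>1 * a\<^sub>2 * b x y"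
    using pos b_gt by simp
  with 1 2 have "a\<^sub>1 * (m * x)\<^sup>2 + a\<^sub>2 * (m * y)\<^sup>2 < a\<^sub>1 * a\<^sub>2 * b x y"
    by (simp add: distrib_left)
  moreover have "det (inertia_matrix B x y) = a\<^sub>1 * a\<^sub>2 * b x y - (a\<^sub>1 * (m * x)\<^sup>2 + a\<^sub>2 * (m * y)\<^sup>2)"
    by (simp add: inertia_matrix_eq det_3 power2_eq_square)
  ultimately have "det (inertia_matrix B x y) \<noteq> 0" by simp
  then show ?thesis by (simp add: invertible_det_nz)
qed

text \<open>Avoids an explicit inverse: applying \<open>R_matrix\<close> to momenta amounts to
  solving the inertia equation for the velocities and rotating their planar part, here by complex
  multiplication.\<close>

lemma R_matrix_mult:
  assumes "a\<^sub>1 * w\<^sub>1 - m * y * w\<^sub>3 = c\<^sub>1" "a\<^sub>2 * w\<^sub>2 + m * x * w\<^sub>3 = c\<^sub>2"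
    "- m * y * w\<^sub>1 + m * x * w\<^sub>2 + b x y * w\<^sub>3 = c\<^sub>3"
  shows "R_matrix B x y \<alpha> *v vector [c\<^sub>1, c\<^sub>2, c\<^sub>3, c\<^sub>4] =
    vector [Re (cis \<alpha> * Complex w\<^sub>1 w\<^sub>2), Im (cis \<alpha> * Complex w\<^sub>1 w\<^sub>2), w\<^sub>3, c\<^sub>4]"
proof -
  let ?A = "inertia_matrix B x y" and ?w = "vector [w\<^sub>1, w\<^sub>2, w\<^sub>3] :: real^3"
  have "?A *v ?w = vector [c\<^sub>1, c\<^sub>2, c\<^sub>3]"
    using assms by (simp add: vec_eq_iff forall_3 matrix_vector_mult_def sum_3 inertia_matrix_eq)
  then have "matrix_inv ?A *v vector [c\<^sub>1, c\<^sub>2, c\<^sub>3] = ?w"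
    using matrix_inv_left[OF invertible_inertia_matrix]
    by (metis matrix_vector_mul_assoc matrix_vector_mul_lid)
  then have N: "(rotation_matrix \<alpha> ** matrix_inv ?A) *v vector [c\<^sub>1, c\<^sub>2, c\<^sub>3] = rotation_matrix \<alpha> *v ?w"
    by (simp flip: matrix_vector_mul_assoc)
  have "(R_matrix B x y \<alpha> *v vector [c\<^sub>1, c\<^sub>2, c\<^sub>3, c\<^sub>4]) =
     (let u = (rotation_matrix \<alpha> ** matrix_inv ?A) *v vector [c\<^sub>1, c\<^sub>2, c\<^sub>3] in vector [u $ 1, u $ 2, u $ 3, c\<^sub>4])"
    by (simp add: vec_eq_iff forall_4 matrix_vector_mult_def sum_3 sum_4 R_matrix_def Let_def)
  also have "\<dots> = vector [Re (cis \<alpha> * Complex w\<^sub>1 w\<^sub>2), Im (cis \<alpha> * Complex w\<^sub>1 w\<^sub>2), w\<^sub>3, c\<^sub>4]"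
    unfolding N by (simp add: rotation_matrix_def matrix_vector_mult_def sum_3 Let_def algebra_simps)
  finally show ?thesis .
qed

abbreviation drift :: "real^4 \<Rightarrow> real^4" where
  "drift \<equiv> V0 B \<xi> \<eta> p\<^sub>x p\<^sub>y K"

lemma deriv_segment: "deriv \<xi> s = k\<^sub>1 * cos s" "deriv \<eta> s = k\<^sub>2 * cos s"
  by (auto intro!: DERIV_imp_deriv derivative_eq_intros)

text \<open>The fields depend on the angles only through sines and cosines, also where the
  derivatives of the segment occur.\<close>

lemma vector_fields_cong:
  assumes "extended_point z = extended_point z'"
  shows "drift z = drift z'" "V1 B \<xi> \<eta> z = V1 B \<xi> \<eta> z'" "V2 B \<xi> \<eta> z = V2 B \<xi> \<eta> z'"
proof -
  have *: "z $ 1 = z' $ 1" "z $ 2 = z' $ 2" "cos (z $ 3) = cos (z' $ 3)" "sin (z $ 3) = sin (z' $ 3)"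
    "cos (z $ 4) = cos (z' $ 4)" "sin (z $ 4) = sin (z' $ 4)"
    using assms by (auto simp: extended_point_def complex_eq_iff)
  have R: "R_matrix B (\<xi> (z $ 4)) (\<eta> (z $ 4)) (z $ 3) = R_matrix B (\<xi> (z' $ 4)) (\<eta> (z' $ 4)) (z' $ 3)"
    unfolding R_matrix_def rotation_matrix_def * by simp
  show "drift z = drift z'" unfolding V0_def Let_def R unfolding * by simp
  show "V1 B \<xi> \<eta> z = V1 B \<xi> \<eta> z'" unfolding V1_def Let_def R deriv_segment unfolding * by simp
  show "V2 B \<xi> \<eta> z = V2 B \<xi> \<eta> z'" unfolding V2_def Let_def R by simp
qed

section \<open>Reachability and concatenation of motions\<close>

definition reachable :: "real \<times> real \<times> complex \<times> complex \<Rightarrow> real \<times> real \<times> complex \<times> complex \<Rightarrow> bool" where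
  "reachable e\<^sub>0 e\<^sub>1 \<longleftrightarrow> (\<exists>T \<sigma>\<^sub>1 \<Omega> z. T \<ge> 0 \<and>
     piecewise_continuous_on 0 T \<sigma>\<^sub>1 \<and> piecewise_continuous_on 0 T \<Omega> \<and>
     is_solution B \<xi> \<eta> p\<^sub>x p\<^sub>y K T \<sigma>\<^sub>1 \<Omega> z \<and>
     extended_point (z 0) = e\<^sub>0 \<and> extended_point (z T) = e\<^sub>1)"

lemma reachable_trans:
  assumes "reachable e\<^sub>0 e\<^sub>1" "reachable e\<^sub>1 e\<^sub>2"
  shows "reachable e\<^sub>0 e\<^sub>2"
proof -
  let ?F = "\<lambda>\<sigma> \<Omega> z t. drift (z t) + \<sigma> t *\<^sub>R V1 B \<xi> \<eta> (z t) + \<Omega> t *\<^sub>R V2 B \<xi> \<eta> (z t)"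
  from assms(1) obtain T \<sigma> \<Omega> z S where T: "0 \<le> T"
    and pc: "piecewise_continuous_on 0 T \<sigma>" "piecewise_continuous_on 0 T \<Omega>"
    and z: "continuous_on {0..T} z" "finite S"
      "\<And>t. t \<in> {0..T} - S \<Longrightarrow> (z has_vector_derivative ?F \<sigma> \<Omega> z t) (at t within {0..T})"
    and e: "extended_point (z 0) = e\<^sub>0" "extended_point (z T) = e\<^sub>1"
    unfolding reachable_def is_solution_def by blast
  from assms(2) obtain T' \<sigma>' \<Omega>' z' S' where T': "0 \<le> T'"
    and pc': "piecewise_continuous_on 0 T' \<sigma>'" "piecewise_continuous_on 0 T' \<Omega>'"
    and z': "continuous_on {0..T'} z'" "finite S'"
      "\<And>t. t \<in> {0..T'} - S' \<Longrightarrow> (z' has_vector_derivative ?F \<sigma>' \<Omega>' z' t) (at t within {0..T'})"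
    and e': "extended_point (z' 0) = e\<^sub>1" "extended_point (z' T') = e\<^sub>2"
    unfolding reachable_def is_solution_def by blast
  have eq: "extended_point (w + (z T - z' 0)) = extended_point w" for w
    using e(2) e'(1) by (intro extended_point_add_diff) simp
  \<comment> \<open>The second motion is delayed by \<open>T\<close> and translated to start at
    \<open>z T\<close>. The translation changes only the angles, by multiples of
    \<open>2 * pi\<close>, so the fields keep their values.\<close>
  define y where "y = (\<lambda>t. z' (t - T) + (z T - z' 0))"
  define Z where "Z = (\<lambda>t. if t \<le> T then z t else y t)"
  define \<Sigma> where "\<Sigma> = (\<lambda>t. if t \<le> T then \<sigma> t else \<sigma>' (t - T))"
  define W where "W = (\<lambda>t. if t \<le> T then \<Omega> t else \<Omega>' (t - T))"
  have pcs: "piecewise_continuous_on 0 (T + T') \<Sigma>" "piecewise_continuous_on 0 (T + T') W"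
    unfolding \<Sigma>_def W_def
    using pc pc' piecewise_continuous_on_shift[of 0 T' _ T]
    by (auto intro!: piecewise_continuous_on_join simp: add.commute)
  have y_cont: "continuous_on {T..T + T'} y"
    unfolding y_def by (intro continuous_intros continuous_on_compose2[OF z'(1)]) auto
  have un: "{0..T + T'} = {0..T} \<union> {T..T + T'}" using T T' by auto
  have "continuous_on ({0..T} \<union> {T..T + T'}) Z"
    unfolding Z_def using z(1) y_cont
    by (intro continuous_on_cases) (auto simp: y_def)
  then have Z_cont: "continuous_on {0..T + T'} Z" by (simp only: un)
  \<comment> \<open>The junction is excluded because the one-sided derivatives may differ
    there.\<close>
  let ?S = "S \<union> (\<lambda>t. t + T) ` S' \<union> {T}"
  have der: "(Z has_vector_derivative ?F \<Sigma> W Z t) (at t within {0..T + T'})"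
    if t: "t \<in> {0..T + T'} - ?S" for t
  proof (cases "t < T")
    case True
    have within: "at t within {0..T} = at t within {0..T + T'}"
      using True T' by (intro at_within_nhd[of t "{..<T}"]) auto
    have "(z has_vector_derivative ?F \<sigma> \<Omega> z t) (at t within {0..T})"
      using z(3)[of t] t True by auto
    also have "?F \<sigma> \<Omega> z t = ?F \<Sigma> W Z t"
      using True by (simp add: Z_def \<Sigma>_def W_def)
    finally have "(z has_vector_derivative ?F \<Sigma> W Z t) (at t within {0..T + T'})"
      unfolding within .
    then show ?thesis
      by (rule has_vector_derivative_transform_within[where d = "T - t"])
         (use t True in \<open>auto simp: Z_def dist_real_def\<close>)
  next
    case False
    then have tT: "T < t" using t by auto
    have "t - T \<in> {0..T'} - S'" using t tT by (force simp: image_iff)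
    then have "(z' has_vector_derivative ?F \<sigma>' \<Omega>' z' (t - T)) (at (t - T) within (\<lambda>t. t - T) ` {T..T + T'})"
      using z'(3) by simp
    then have "((z' \<circ> (\<lambda>t. t - T)) has_vector_derivative 1 *\<^sub>R ?F \<sigma>' \<Omega>' z' (t - T)) (at t within {T..T + T'})"
      by (rule vector_diff_chain_within[rotated]) (auto intro!: derivative_eq_intros)
    then have "(y has_vector_derivative ?F \<sigma>' \<Omega>' z' (t - T)) (at t within {T..T + T'})"
      unfolding y_def by (auto intro!: derivative_eq_intros simp: o_def)
    moreover have "?F \<sigma>' \<Omega>' z' (t - T) = ?F \<Sigma> W Z t"
      using tT vector_fields_cong[OF eq, of "z' (t - T)"] by (simp add: Z_def y_def \<Sigma>_def W_def)
    moreover have "at t within {T..T + T'} = at t within {0..T + T'}"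
      using tT T by (intro at_within_nhd[of t "{T<..}"]) auto
    ultimately have "(y has_vector_derivative ?F \<Sigma> W Z t) (at t within {0..T + T'})"
      by simp
    then show ?thesis
      by (rule has_vector_derivative_transform_within[where d = "t - T"])
         (use t tT in \<open>auto simp: Z_def dist_real_def\<close>)
  qed
  have "finite ?S" using z(2) z'(2) by auto
  with der have "\<exists>S. finite S \<and> (\<forall>t\<in>{0..T + T'} - S.
      (Z has_vector_derivative ?F \<Sigma> W Z t) (at t within {0..T + T'}))"
    by (intro exI[of _ ?S] conjI ballI)
  with Z_cont have sol: "is_solution B \<xi> \<eta> p\<^sub>x p\<^sub>y K (T + T') \<Sigma> W Z"
    unfolding is_solution_def by (rule conjI)
  have start: "extended_point (Z 0) = e\<^sub>0" using e T by (simp add: Z_def)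
  have "Z (T + T') = y (T + T')" using T' by (auto simp: Z_def y_def)
  then have "extended_point (Z (T + T')) = e\<^sub>2" using e'(2) eq by (simp add: y_def)
  with T T' pcs sol start show ?thesis
    unfolding reachable_def
    by (intro exI[of _ "T + T'"] exI[of _ \<Sigma>] exI[of _ W] exI[of _ Z] conjI) auto
qed

section \<open>Prescribing both angles with the help of the rotor\<close>

definition drag :: "complex \<Rightarrow> complex" where
  "drag z = Complex (Re z / a\<^sub>1) (Im z / a\<^sub>2)"

lemma a_nz: "a\<^sub>1 \<noteq> 0" "a\<^sub>2 \<noteq> 0"
  using m_pos a\<^sub>1_gt a\<^sub>2_gt by auto

lemma drag_mult: "a\<^sub>1 * Re (drag z) = Re z" "a\<^sub>2 * Im (drag z) = Im z"
  using a_nz by (simp_all add: drag_def)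

text \<open>The solution \<open>v\<^sub>1 + \<i> * v\<^sub>2\<close> of the first two rows of the
  inertia equation for prescribed angular velocity \<open>\<alpha>'\<close>. The term with
  \<open>sin s * \<alpha>'\<close> stems from the off-diagonal entries \<open>f\<close> and
  \<open>g\<close>.\<close>

definition body_velocity :: "real \<Rightarrow> real \<Rightarrow> real \<Rightarrow> real \<Rightarrow> complex \<Rightarrow> complex" where
  "body_velocity \<alpha> s \<alpha>' s' p = drag (cis (- \<alpha>) * (Complex p\<^sub>x p\<^sub>y + \<i> * of_real (lambda B) * p)
     + Complex (chi B) (zeta B)
     - of_real m * Complex k\<^sub>1 k\<^sub>2 * (of_real (cos s * s') + \<i> * of_real (sin s * \<alpha>')))"

definition velocity :: "real \<Rightarrow> real \<Rightarrow> real \<Rightarrow> real \<Rightarrow> complex \<Rightarrow> complex" where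
  "velocity \<alpha> s \<alpha>' s' p = cis \<alpha> * body_velocity \<alpha> s \<alpha>' s' p"

text \<open>Choosing the rotor speed to balance the third row frees the angle of the body. Both
  angles may then follow any continuously differentiable path, and only \<open>p\<close> remains
  subject to a differential equation, from which \<open>K\<close> and the rotor have
  disappeared.\<close>

lemma reachable_of_shape_path:
  assumes T: "0 \<le> T"
    and \<alpha>: "\<And>t. t \<in> {0..T} \<Longrightarrow> (\<alpha> has_real_derivative \<alpha>' t) (at t within {0..T})"
    and s: "\<And>t. t \<in> {0..T} \<Longrightarrow> (s has_real_derivative s' t) (at t within {0..T})"
    and cont: "continuous_on {0..T} \<alpha>'" "continuous_on {0..T} s'"
    and p: "\<And>t. t \<in> {0..T} \<Longrightarrow>
      (p has_vector_derivative velocity (\<alpha> t) (s t) (\<alpha>' t) (s' t) (p t)) (at t within {0..T})"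
  shows "reachable (Re (p 0), Im (p 0), cis (\<alpha> 0), cis (s 0)) (Re (p T), Im (p T), cis (\<alpha> T), cis (s T))"
proof -
  define w where "w = (\<lambda>t. body_velocity (\<alpha> t) (s t) (\<alpha>' t) (s' t) (p t))"
  define z :: "real \<Rightarrow> real^4" where "z = (\<lambda>t. vector [Re (p t), Im (p t), \<alpha> t, s t])"
  \<comment> \<open>The third row of the inertia equation, solved for the rotor speed.\<close>
  define \<Omega> where "\<Omega> = (\<lambda>t. (K - lambda B / 2 * ((Re (p t))\<^sup>2 + (Im (p t))\<^sup>2) - Re (p t) * p\<^sub>y + Im (p t) * p\<^sub>x
     - (- m * \<eta> (s t) * Re (w t) + m * \<xi> (s t) * Im (w t) + b (\<xi> (s t)) (\<eta> (s t)) * \<alpha>' t)) / rotor_inertia B)"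
  have cont_p: "continuous_on {0..T} p" using p by (rule continuous_on_vector_derivative)
  note cont' = cont cont_p DERIV_continuous_on[OF \<alpha>] DERIV_continuous_on[OF s]
  have "continuous_on {0..T} w"
    unfolding w_def body_velocity_def drag_def using a_nz by (intro continuous_intros cont') auto
  then have "continuous_on {0..T} \<Omega>"
    unfolding \<Omega>_def b_def using rotor_inertia_nz by (intro continuous_intros cont') auto
  then have pc: "piecewise_continuous_on 0 T s'" "piecewise_continuous_on 0 T \<Omega>"
    using cont by (auto intro: continuous_imp_piecewise_continuous_on)
  have deriv: "(z has_vector_derivative
      drift (z t) + s' t *\<^sub>R V1 B \<xi> \<eta> (z t) + \<Omega> t *\<^sub>R V2 B \<xi> \<eta> (z t)) (at t within {0..T})"
    if t: "t \<in> {0..T}" for t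
  proof -
    let ?x = "Re (p t)" and ?y = "Im (p t)"
    let ?R = "R_matrix B (\<xi> (s t)) (\<eta> (s t)) (\<alpha> t)"
    let ?X = "(p\<^sub>x - lambda B * ?y) * cos (\<alpha> t) + (p\<^sub>y + lambda B * ?x) * sin (\<alpha> t) + chi B"
    let ?Y = "- (p\<^sub>x - lambda B * ?y) * sin (\<alpha> t) + (p\<^sub>y + lambda B * ?x) * cos (\<alpha> t) + zeta B"
    let ?Z = "K - lambda B / 2 * (?x\<^sup>2 + ?y\<^sup>2) - ?x * p\<^sub>y + ?y * p\<^sub>x"
    have V: "drift (z t) = ?R *v vector [?X, ?Y, ?Z, 0]"
      "V1 B \<xi> \<eta> (z t) = ?R *v vector [- m * (k\<^sub>1 * cos (s t)), - m * (k\<^sub>2 * cos (s t)),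
         m * (\<eta> (s t) * (k\<^sub>1 * cos (s t)) - \<xi> (s t) * (k\<^sub>2 * cos (s t))), 1]"
      "V2 B \<xi> \<eta> (z t) = ?R *v vector [0, 0, - rotor_inertia B, 0]"
      unfolding V0_def V1_def V2_def Let_def z_def vector_4 deriv_segment by (rule refl)+
    \<comment> \<open>The segment lies on a line through the origin of the body frame, so the
      relative motion of the mass has no angular momentum about that origin.\<close>
    have eq: "m * (\<eta> (s t) * (k\<^sub>1 * cos (s t)) - \<xi> (s t) * (k\<^sub>2 * cos (s t))) = 0"
      by simp
    have "drift (z t) + s' t *\<^sub>R V1 B \<xi> \<eta> (z t) + \<Omega> t *\<^sub>R V2 B \<xi> \<eta> (z t) =
      ?R *v (vector [?X, ?Y, ?Z, 0]
        + s' t *\<^sub>R vector [- m * (k\<^sub>1 * cos (s t)), - m * (k\<^sub>2 * cos (s t)), 0, 1]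
        + \<Omega> t *\<^sub>R vector [0, 0, - rotor_inertia B, 0])"
      using V eq by (simp add: matrix_vector_right_distrib matrix_vector_mult_scaleR)
    also have "vector [?X, ?Y, ?Z, 0]
        + s' t *\<^sub>R vector [- m * (k\<^sub>1 * cos (s t)), - m * (k\<^sub>2 * cos (s t)), 0, 1]
        + \<Omega> t *\<^sub>R vector [0, 0, - rotor_inertia B, 0] =
      (vector [?X - m * k\<^sub>1 * cos (s t) * s' t, ?Y - m * k\<^sub>2 * cos (s t) * s' t,
        ?Z - rotor_inertia B * \<Omega> t, s' t] :: real^4)"
      by (simp add: vec_eq_iff forall_4 algebra_simps)
    also have "?R *v \<dots> = vector [Re (cis (\<alpha> t) * Complex (Re (w t)) (Im (w t))),
        Im (cis (\<alpha> t) * Complex (Re (w t)) (Im (w t))), \<alpha>' t, s' t]"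
    proof (rule R_matrix_mult)
      show "a\<^sub>1 * Re (w t) - m * \<eta> (s t) * \<alpha>' t = ?X - m * k\<^sub>1 * cos (s t) * s' t"
        unfolding w_def body_velocity_def drag_mult by (simp add: algebra_simps)
      show "a\<^sub>2 * Im (w t) + m * \<xi> (s t) * \<alpha>' t = ?Y - m * k\<^sub>2 * cos (s t) * s' t"
        unfolding w_def body_velocity_def drag_mult by (simp add: algebra_simps)
      show "- m * \<eta> (s t) * Re (w t) + m * \<xi> (s t) * Im (w t) + b (\<xi> (s t)) (\<eta> (s t)) * \<alpha>' t
          = ?Z - rotor_inertia B * \<Omega> t"
        using rotor_inertia_nz by (simp add: \<Omega>_def)
    qed
    also have "\<dots> = vector [Re (velocity (\<alpha> t) (s t) (\<alpha>' t) (s' t) (p t)),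
        Im (velocity (\<alpha> t) (s t) (\<alpha>' t) (s' t) (p t)), \<alpha>' t, s' t]"
      unfolding velocity_def w_def complex.collapse by (rule refl)
    finally show ?thesis
      unfolding z_def
      using p[OF t] \<alpha>[OF t] s[OF t]
      by (auto intro!: has_vector_derivative_vector_4 has_field_derivative_Re has_field_derivative_Im)
  qed
  have "continuous_on {0..T} z" using deriv by (rule continuous_on_vector_derivative)
  then have "is_solution B \<xi> \<eta> p\<^sub>x p\<^sub>y K T s' \<Omega> z"
    unfolding is_solution_def using deriv by blast
  then show ?thesis
    unfolding reachable_def using T pc
    by (intro exI[of _ T] exI[of _ s'] exI[of _ \<Omega>] exI[of _ z]) (auto simp: extended_point_def z_def)
qed

section \<open>Motion of the centre of mass\<close>

text \<open>The isotropic part and, in the next definition, the anisotropic part of the inverse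
  planar inertia with diagonal entries \<open>1 / a\<^sub>1\<close> and
  \<open>1 / a\<^sub>2\<close>.\<close>

definition d\<^sub>s :: real where "d\<^sub>s = (1 / a\<^sub>1 + 1 / a\<^sub>2) / 2"
definition d\<^sub>d :: real where "d\<^sub>d = (1 / a\<^sub>1 - 1 / a\<^sub>2) / 2"

text \<open>This is \<open>drag\<close> seen from the fixed frame, see \<open>mobility_eq\<close>.
  Conjugation reverses rotations, hence the factor \<open>cis (2 * \<alpha>)\<close> on the
  anisotropic part alone.\<close>

definition mobility :: "real \<Rightarrow> complex \<Rightarrow> complex" where
  "mobility \<alpha> z = of_real d\<^sub>s * z + of_real d\<^sub>d * (cis (2 * \<alpha>) * cnj z)"

abbreviation direction :: complex where "direction \<equiv> Complex k\<^sub>1 k\<^sub>2"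

lemma d_diff_nz: "d\<^sub>d \<noteq> 0"
  using a_nz a_neq by (simp add: d\<^sub>d_def)

lemma drag_conj: "drag z = of_real d\<^sub>s * z + of_real d\<^sub>d * cnj z"
proof -
  have "(d\<^sub>s + d\<^sub>d) = 1 / a\<^sub>1" "(d\<^sub>s - d\<^sub>d) = 1 / a\<^sub>2"
    by (simp_all add: d\<^sub>s_def d\<^sub>d_def field_simps)
  then have "Re z / a\<^sub>1 = (d\<^sub>s + d\<^sub>d) * Re z" "Im z / a\<^sub>2 = (d\<^sub>s - d\<^sub>d) * Im z"
    by simp_all
  then show ?thesis
    by (simp add: complex_eq_iff drag_def algebra_simps)
qed

lemma mobility_eq: "mobility \<alpha> z = cis \<alpha> * drag (cis (- \<alpha>) * z)"
proof -
  have "cis (2 * \<alpha>) = cis \<alpha> * cis \<alpha>" by (simp add: cis_mult)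
  moreover have "cis \<alpha> * cis (- \<alpha>) = 1" by (simp add: cis_mult)
  ultimately show ?thesis
    by (simp add: mobility_def drag_conj cis_cnj algebra_simps)
qed

lemma mobility_cis: "mobility \<alpha> (cis \<alpha> * z) = of_real d\<^sub>s * (cis \<alpha> * z) + of_real d\<^sub>d * (cis \<alpha> * cnj z)"
proof -
  have "cis (2 * \<alpha>) * cnj (cis \<alpha>) = cis \<alpha>" by (simp add: cis_cnj cis_mult)
  then have "cis (2 * \<alpha>) * (cnj (cis \<alpha>) * w) = cis \<alpha> * w" for w
    by (simp only: mult.assoc[symmetric])
  then show ?thesis by (simp add: mobility_def)
qed

lemma mobility_add: "mobility \<alpha> (z + w) = mobility \<alpha> z + mobility \<alpha> w"
  by (simp add: mobility_def algebra_simps)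

lemma mobility_diff: "mobility \<alpha> (z - w) = mobility \<alpha> z - mobility \<alpha> w"
  by (simp add: mobility_def algebra_simps)

lemma mobility_scaleR: "mobility \<alpha> (c *\<^sub>R z) = c *\<^sub>R mobility \<alpha> z"
  by (simp add: mobility_def scaleR_conv_of_real algebra_simps)

lemma norm_mobility: "norm (mobility \<alpha> z) \<le> (\<bar>d\<^sub>s\<bar> + \<bar>d\<^sub>d\<bar>) * norm z"
proof -
  have "norm (mobility \<alpha> z) \<le> norm (of_real d\<^sub>s * z) + norm (of_real d\<^sub>d * (cis (2 * \<alpha>) * cnj z))"
    unfolding mobility_def by (rule norm_triangle_ineq)
  also have "\<dots> = (\<bar>d\<^sub>s\<bar> + \<bar>d\<^sub>d\<bar>) * norm z"
    by (simp add: norm_mult algebra_simps)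
  finally show ?thesis .
qed

lemma continuous_on_mobility [continuous_intros]:
  assumes "continuous_on S f" "continuous_on S g"
  shows "continuous_on S (\<lambda>x. mobility (f x) (g x))"
  unfolding mobility_def by (intro continuous_intros assms)

section \<open>Splitting the velocity into circulation, background and thrust\<close>

definition coriolis :: "real \<Rightarrow> complex \<Rightarrow> complex" where
  "coriolis \<alpha> p = mobility \<alpha> (\<i> * of_real (lambda B) * p)"

text \<open>A Lipschitz constant in \<open>p\<close>, uniform in the angle: short-time estimates
  hold however fast the body turns.\<close>

definition rate :: real where
  "rate = (\<bar>d\<^sub>s\<bar> + \<bar>d\<^sub>d\<bar>) * \<bar>lambda B\<bar>"

lemma rate_nonneg: "0 \<le> rate"
  by (simp add: rate_def)

lemma coriolis_add: "coriolis \<alpha> (p + q) = coriolis \<alpha> p + coriolis \<alpha> q"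
  by (simp add: coriolis_def distrib_left mobility_add)

lemma coriolis_diff: "coriolis \<alpha> (p - q) = coriolis \<alpha> p - coriolis \<alpha> q"
  by (simp add: coriolis_def right_diff_distrib mobility_diff)

lemma coriolis_scaleR: "coriolis \<alpha> (c *\<^sub>R p) = c *\<^sub>R coriolis \<alpha> p"
  by (simp add: coriolis_def mobility_scaleR)

lemma norm_coriolis: "norm (coriolis \<alpha> p) \<le> rate * norm p"
  using norm_mobility[of \<alpha> "\<i> * of_real (lambda B) * p"]
  by (simp add: coriolis_def rate_def norm_mult mult.assoc)

definition background :: "real \<Rightarrow> complex" where
  "background \<alpha> = mobility \<alpha> (Complex p\<^sub>x p\<^sub>y + cis \<alpha> * Complex (chi B) (zeta B))"

definition thrust :: "real \<Rightarrow> real \<Rightarrow> real \<Rightarrow> real \<Rightarrow> complex" where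
  "thrust \<alpha> u \<alpha>' u' =
     - (of_real m * mobility \<alpha> (cis \<alpha> * (direction * (of_real u' + \<i> * of_real (u * \<alpha>')))))"

text \<open>The mass enters only through \<open>u = sin s\<close> and its time derivative
  \<open>cos s * s'\<close>, linearly for a given turning of the body. A motion can thus be designed
  in terms of \<open>u\<close>, and \<open>s\<close> recovered afterwards.\<close>

lemma velocity_eq:
  "velocity \<alpha> s \<alpha>' s' p =
     coriolis \<alpha> p + (background \<alpha> + thrust \<alpha> (sin s) \<alpha>' (cos s * s'))"
proof -
  have 1: "cis (- \<alpha>) * (cis \<alpha> * w) = w" for w
    by (simp flip: mult.assoc add: cis_mult)
  have 2: "cis (- \<alpha>) * (of_real m * (cis \<alpha> * w)) = of_real m * w" for w
    by (simp only: mult.left_commute[of "cis (- \<alpha>)" "of_real m"] 1)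
  let ?W = "direction * (of_real (cos s * s') + \<i> * of_real (sin s * \<alpha>'))"
  let ?Y = "\<i> * of_real (lambda B) * p + (Complex p\<^sub>x p\<^sub>y + cis \<alpha> * Complex (chi B) (zeta B))
     - of_real m * (cis \<alpha> * ?W)"
  have "velocity \<alpha> s \<alpha>' s' p = cis \<alpha> * drag (cis (- \<alpha>) * ?Y)"
    unfolding velocity_def body_velocity_def right_diff_distrib[of "cis (- \<alpha>)"]
      distrib_left[of "cis (- \<alpha>)"] 1 2
    by (simp only: mult.assoc add.assoc add.left_commute add.commute)
  also have "\<dots> = mobility \<alpha> (\<i> * of_real (lambda B) * p + (Complex p\<^sub>x p\<^sub>y + cis \<alpha> * Complex (chi B) (zeta B))
     - m *\<^sub>R (cis \<alpha> * ?W))"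
    by (simp only: mobility_eq scaleR_conv_of_real)
  finally show ?thesis
    unfolding mobility_diff mobility_add mobility_scaleR coriolis_def background_def thrust_def
    unfolding scaleR_conv_of_real by simp
qed

lemma continuous_on_background [continuous_intros]:
  assumes "continuous_on S f"
  shows "continuous_on S (\<lambda>x. background (f x))"
  unfolding background_def by (intro continuous_intros assms)

lemma continuous_on_thrust [continuous_intros]:
  assumes "continuous_on S f" "continuous_on S g" "continuous_on S f'" "continuous_on S g'"
  shows "continuous_on S (\<lambda>x. thrust (f x) (g x) (f' x) (g' x))"
  unfolding thrust_def by (intro continuous_intros assms)

lemma norm_background:
  "norm (background \<alpha>) \<le> (\<bar>d\<^sub>s\<bar> + \<bar>d\<^sub>d\<bar>) * (norm (Complex p\<^sub>x p\<^sub>y) + norm (Complex (chi B) (zeta B)))"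
proof -
  have "norm (Complex p\<^sub>x p\<^sub>y + cis \<alpha> * Complex (chi B) (zeta B))
      \<le> norm (Complex p\<^sub>x p\<^sub>y) + norm (Complex (chi B) (zeta B))"
    by (rule norm_triangle_le) (simp add: norm_mult)
  then show ?thesis
    unfolding background_def by (intro order_trans[OF norm_mobility] mult_left_mono) auto
qed

lemma norm_thrust:
  "norm (thrust \<alpha> u \<alpha>' u') \<le> m * ((\<bar>d\<^sub>s\<bar> + \<bar>d\<^sub>d\<bar>) * (norm direction * (\<bar>u'\<bar> + \<bar>u\<bar> * \<bar>\<alpha>'\<bar>)))"
proof -
  have "norm (of_real u' + \<i> * of_real (u * \<alpha>')) \<le> \<bar>u'\<bar> + \<bar>u\<bar> * \<bar>\<alpha>'\<bar>"
    by (rule norm_triangle_le) (simp add: norm_mult abs_mult)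
  then have "norm (cis \<alpha> * (direction * (of_real u' + \<i> * of_real (u * \<alpha>'))))
      \<le> norm direction * (\<bar>u'\<bar> + \<bar>u\<bar> * \<bar>\<alpha>'\<bar>)"
    unfolding norm_mult norm_cis by (simp add: mult_left_mono)
  then have "norm (mobility \<alpha> (cis \<alpha> * (direction * (of_real u' + \<i> * of_real (u * \<alpha>')))))
      \<le> (\<bar>d\<^sub>s\<bar> + \<bar>d\<^sub>d\<bar>) * (norm direction * (\<bar>u'\<bar> + \<bar>u\<bar> * \<bar>\<alpha>'\<bar>))"
    by (intro order_trans[OF norm_mobility] mult_left_mono) auto
  then have "m * norm (mobility \<alpha> (cis \<alpha> * (direction * (of_real u' + \<i> * of_real (u * \<alpha>')))))
      \<le> m * ((\<bar>d\<^sub>s\<bar> + \<bar>d\<^sub>d\<bar>) * (norm direction * (\<bar>u'\<bar> + \<bar>u\<bar> * \<bar>\<alpha>'\<bar>)))"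
    using m_pos by (intro mult_left_mono) auto
  then show ?thesis
    using m_pos by (simp add: thrust_def norm_mult)
qed

text \<open>The equation is affine in \<open>p\<close> with Lipschitz constant \<open>rate\<close>,
  so the admissible length \<open>T\<close> does not depend on \<open>\<alpha>\<close>,
  \<open>e\<close> or \<open>q\<close>.\<close>

lemma drift_solution:
  assumes "t\<^sub>0 \<in> {0..T}" "rate * T < 1" "continuous_on {0..T} \<alpha>" "continuous_on {0..T} e"
  obtains p where "p t\<^sub>0 = q"
    and "\<And>t. t \<in> {0..T} \<Longrightarrow>
      (p has_vector_derivative coriolis (\<alpha> t) (p t) + e t) (at t within {0..T})"
proof (rule picard_lindelof_short_time[of t\<^sub>0 T "\<lambda>t p. coriolis (\<alpha> t) p + e t" rate q])
  show "continuous_on ({0..T} \<times> UNIV) (\<lambda>(t, p). coriolis (\<alpha> t) p + e t)"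
    unfolding split_beta coriolis_def
    by (intro continuous_intros continuous_on_compose2[OF assms(3)] continuous_on_compose2[OF assms(4)])
       auto
  show "norm (coriolis (\<alpha> t) p + e t - (coriolis (\<alpha> t) q + e t)) \<le> rate * norm (p - q)" for t p q
    using norm_coriolis[of "\<alpha> t" "p - q"] by (simp add: coriolis_diff)
qed (use assms rate_nonneg that in auto)

abbreviation state :: "complex \<Rightarrow> real \<Rightarrow> real \<Rightarrow> real \<times> real \<times> complex \<times> complex" where
  "state p \<alpha> s \<equiv> (Re p, Im p, cis \<alpha>, cis s)"

text \<open>Both angles run linearly to their targets. Prescribing the position at time 0 or at time
  \<open>T\<close> fixes one end of the motion; the other end is whatever results.\<close>

lemma reachable_shape_from:
  "\<exists>p. reachable (state q \<alpha>\<^sub>0 s\<^sub>0) (state p \<alpha>\<^sub>1 s\<^sub>1)"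
  and reachable_shape_to:
  "\<exists>p. reachable (state p \<alpha>\<^sub>0 s\<^sub>0) (state q \<alpha>\<^sub>1 s\<^sub>1)"
proof -
  define T where "T = 1 / (rate + 1)"
  have T: "0 < T" "rate * T < 1" using rate_nonneg by (auto simp: T_def field_simps)
  define \<alpha> where "\<alpha> = (\<lambda>t. \<alpha>\<^sub>0 + (\<alpha>\<^sub>1 - \<alpha>\<^sub>0) / T * t)"
  define s where "s = (\<lambda>t. s\<^sub>0 + (s\<^sub>1 - s\<^sub>0) / T * t)"
  define e where
    "e = (\<lambda>t. background (\<alpha> t) + thrust (\<alpha> t) (sin (s t)) ((\<alpha>\<^sub>1 - \<alpha>\<^sub>0) / T) (cos (s t) * ((s\<^sub>1 - s\<^sub>0) / T)))"
  have ends: "\<alpha> 0 = \<alpha>\<^sub>0" "s 0 = s\<^sub>0" "\<alpha> T = \<alpha>\<^sub>1" "s T = s\<^sub>1"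
    using less_imp_neq[OF T(1), symmetric] by (simp_all add: \<alpha>_def s_def)
  have *: "\<exists>p. p t\<^sub>0 = q \<and> reachable (state (p 0) \<alpha>\<^sub>0 s\<^sub>0) (state (p T) \<alpha>\<^sub>1 s\<^sub>1)"
    if t0: "t\<^sub>0 \<in> {0..T}" for t\<^sub>0
  proof -
    have "continuous_on {0..T} \<alpha>" "continuous_on {0..T} e"
      unfolding e_def unfolding \<alpha>_def s_def by (intro continuous_intros; simp)+
    from drift_solution[OF t0 T(2) this] obtain p where p: "p t\<^sub>0 = q"
      "\<And>t. t \<in> {0..T} \<Longrightarrow> (p has_vector_derivative coriolis (\<alpha> t) (p t) + e t) (at t within {0..T})"
      by blast
    have "reachable (state (p 0) (\<alpha> 0) (s 0)) (state (p T) (\<alpha> T) (s T))"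
    proof (rule reachable_of_shape_path)
      show "(\<alpha> has_real_derivative (\<alpha>\<^sub>1 - \<alpha>\<^sub>0) / T) (at t within {0..T})"
        "(s has_real_derivative (s\<^sub>1 - s\<^sub>0) / T) (at t within {0..T})" for t
        unfolding \<alpha>_def s_def using T by (auto intro!: derivative_eq_intros)
      show "(p has_vector_derivative velocity (\<alpha> t) (s t) ((\<alpha>\<^sub>1 - \<alpha>\<^sub>0) / T) ((s\<^sub>1 - s\<^sub>0) / T) (p t))
          (at t within {0..T})" if "t \<in> {0..T}" for t
        using p(2)[OF that] by (simp add: velocity_eq e_def)
    qed (use T in auto)
    with p(1) show ?thesis unfolding ends by blast
  qed
  show "\<exists>p. reachable (state q \<alpha>\<^sub>0 s\<^sub>0) (state p \<alpha>\<^sub>1 s\<^sub>1)" using *[of 0] T by auto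
  show "\<exists>p. reachable (state p \<alpha>\<^sub>0 s\<^sub>0) (state q \<alpha>\<^sub>1 s\<^sub>1)" using *[of T] T by auto
qed

text \<open>
  This amplitude of the internal mass vanishes at both ends of a turn, and the integral of
  \<open>cis \<alpha> * stroke r \<alpha>\<close> over the turn is \<open>- \<pi> * cnj r\<close>, which covers all directions.
\<close>

definition stroke :: "complex \<Rightarrow> real \<Rightarrow> real" where
  "stroke r \<alpha> = Re (r * (1 - cis \<alpha>))"

definition stroke' :: "complex \<Rightarrow> real \<Rightarrow> real" where
  "stroke' r \<alpha> = Re (- (r * \<i> * cis \<alpha>))"

lemma stroke_deriv:
  "(stroke r has_real_derivative stroke' r \<alpha>) (at \<alpha> within S)"
  unfolding stroke_def stroke'_def
  by (auto intro!: derivative_eq_intros has_vector_derivative_real_field simp: algebra_simps)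

lemma continuous_on_stroke [continuous_intros]:
  assumes "continuous_on S f"
  shows "continuous_on S (\<lambda>x. stroke r (f x))" "continuous_on S (\<lambda>x. stroke' r (f x))"
  unfolding stroke_def stroke'_def by (intro continuous_intros assms)+

lemma abs_stroke: "\<bar>stroke r \<alpha>\<bar> \<le> 2 * norm r" "\<bar>stroke' r \<alpha>\<bar> \<le> norm r"
proof -
  have "norm (1 - cis \<alpha>) \<le> 2" using norm_triangle_ineq4[of 1 "cis \<alpha>"] by simp
  then have "norm (r * (1 - cis \<alpha>)) \<le> norm r * 2"
    unfolding norm_mult by (intro mult_left_mono) auto
  then show "\<bar>stroke r \<alpha>\<bar> \<le> 2 * norm r"
    unfolding stroke_def using abs_Re_le_cmod by (smt (verit))
  show "\<bar>stroke' r \<alpha>\<bar> \<le> norm r"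
    unfolding stroke'_def using abs_Re_le_cmod[of "- (r * \<i> * cis \<alpha>)"] by (simp add: norm_mult)
qed

lemma stroke_linear:
  "stroke r \<alpha> = Re r * stroke 1 \<alpha> + Im r * stroke \<i> \<alpha>"
  "stroke' r \<alpha> = Re r * stroke' 1 \<alpha> + Im r * stroke' \<i> \<alpha>"
  by (simp_all add: stroke_def stroke'_def algebra_simps)

section \<open>The displacement produced by one full turn\<close>

definition gait :: "complex \<Rightarrow> real \<Rightarrow> real \<Rightarrow> complex" where
  "gait r w t = thrust (w * t) (stroke r (w * t)) w (stroke' r (w * t) * w)"

text \<open>Real linearity in \<open>r\<close> lets the responses for \<open>1\<close> and
  \<open>\<i>\<close> generate all others.\<close>

lemma gait_linear: "gait r w t = Re r *\<^sub>R gait 1 w t + Im r *\<^sub>R gait \<i> w t"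
proof -
  let ?v = "\<lambda>r. cis (w * t) * (direction * (of_real (stroke' r (w * t) * w) + \<i> * of_real (stroke r (w * t) * w)))"
  have "?v r = Re r *\<^sub>R ?v 1 + Im r *\<^sub>R ?v \<i>"
    unfolding stroke_linear[of r] by (simp add: scaleR_conv_of_real algebra_simps)
  then have "mobility (w * t) (?v r) = Re r *\<^sub>R mobility (w * t) (?v 1) + Im r *\<^sub>R mobility (w * t) (?v \<i>)"
    by (simp only: mobility_add mobility_scaleR)
  then show ?thesis
    unfolding gait_def thrust_def by (simp only: scaleR_conv_of_real) (simp add: algebra_simps)
qed

lemma continuous_on_gait: "continuous_on S (gait r w)"
  unfolding gait_def by (intro continuous_intros)

text \<open>One full turn under the thrust alone displaces the body by
  \<open>gait_gain * cnj r\<close>. Only the anisotropic part \<open>d\<^sub>d\<close>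
  contributes.\<close>

definition gait_gain :: complex where
  "gait_gain = - (2 * of_real pi * \<i> * of_real (m * d\<^sub>d) * cnj direction)"

lemma gait_gain_nz: "gait_gain \<noteq> 0"
  using m_pos d_diff_nz segment by (auto simp: gait_gain_def complex_eq_iff)

text \<open>Per unit of \<open>norm r\<close>, a bound on the thrust times the duration
  \<open>T\<close> of a turn; at angular velocity \<open>2 * pi / T\<close> the duration
  cancels.\<close>

definition gait_bound :: real where
  "gait_bound = 6 * pi * m * (\<bar>d\<^sub>s\<bar> + \<bar>d\<^sub>d\<bar>) * norm direction"

lemma norm_gait:
  assumes "0 \<le> w"
  shows "norm (gait r w t) \<le> m * ((\<bar>d\<^sub>s\<bar> + \<bar>d\<^sub>d\<bar>) * (norm direction * (3 * norm r * w)))"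
proof -
  have "\<bar>stroke' r (w * t) * w\<bar> + \<bar>stroke r (w * t)\<bar> * \<bar>w\<bar> = \<bar>stroke' r (w * t)\<bar> * w + \<bar>stroke r (w * t)\<bar> * w"
    using assms by (simp add: abs_mult)
  also have "\<dots> \<le> norm r * w + 2 * norm r * w"
    using assms by (intro add_mono mult_right_mono abs_stroke)
  finally have "\<bar>stroke' r (w * t) * w\<bar> + \<bar>stroke r (w * t)\<bar> * \<bar>w\<bar> \<le> 3 * norm r * w"
    by linarith
  then have "m * ((\<bar>d\<^sub>s\<bar> + \<bar>d\<^sub>d\<bar>) * (norm direction * (\<bar>stroke' r (w * t) * w\<bar> + \<bar>stroke r (w * t)\<bar> * \<bar>w\<bar>)))
     \<le> m * ((\<bar>d\<^sub>s\<bar> + \<bar>d\<^sub>d\<bar>) * (norm direction * (3 * norm r * w)))"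
    using m_pos by (intro mult_left_mono) auto
  then show ?thesis unfolding gait_def by (rule order_trans[OF norm_thrust])
qed

text \<open>The isotropic part involves \<open>cis \<alpha> * (u' + \<i> * u * \<alpha>')\<close>,
  the derivative of \<open>cis \<alpha> * u\<close>, and contributes nothing over a turn because
  \<open>u\<close> vanishes at both ends. Conjugation changes the sign of \<open>\<i>\<close> in the
  anisotropic part, which leaves the extra term
  \<open>- 2 * \<i> * u * \<alpha>' * cis \<alpha>\<close>; its integral is the source of the
  displacement.\<close>

lemma gait_antiderivative:
  obtains G where "\<And>t S. (G has_vector_derivative gait r w t) (at t within S)"
    and "\<And>T. w * T = 2 * pi \<Longrightarrow> G T - G 0 = gait_gain * cnj r"
proof
  \<comment> \<open>An antiderivative of \<open>cis \<alpha> * stroke r \<alpha>\<close> in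
    \<open>\<alpha>\<close>, found by writing \<open>stroke\<close> in terms of
    \<open>cis \<alpha>\<close> and its inverse.\<close>
  define Q where "Q = (\<lambda>\<alpha>. ((r + cnj r) * cis \<alpha> / \<i> - r * (cis \<alpha> * cis \<alpha>) / (2 * \<i>) - cnj r * of_real \<alpha>) / 2)"
  define G where "G = (\<lambda>t. - (of_real m * (of_real d\<^sub>s * (direction * (cis (w * t) * of_real (stroke r (w * t))))
     + of_real d\<^sub>d * (cnj direction * (cis (w * t) * of_real (stroke r (w * t)) - 2 * \<i> * Q (w * t))))))"
  have cis_deriv: "((\<lambda>t. cis (w * t)) has_vector_derivative \<i> * of_real w * cis (w * t)) (at t within S)" for t S
    unfolding has_vector_derivative_def
    by (auto intro!: derivative_eq_intros simp: scaleR_conv_of_real algebra_simps)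
  have stroke_deriv': "((\<lambda>t. stroke r (w * t)) has_real_derivative stroke' r (w * t) * w) (at t within S)" for t S
    by (rule DERIV_chain2[OF stroke_deriv]) (auto intro!: derivative_eq_intros)
  have stroke_eq: "of_real (stroke r \<alpha>) = (r * (1 - cis \<alpha>) + cnj r * (1 - inverse (cis \<alpha>))) / 2" for \<alpha>
    using complex_add_cnj[of "r * (1 - cis \<alpha>)"] by (simp add: stroke_def cis_cnj)
  have Q: "((\<lambda>t. Q (w * t)) has_vector_derivative of_real w * (cis (w * t) * of_real (stroke r (w * t))))
      (at t within S)" for t S
  proof -
    have "((\<lambda>t. Q (w * t)) has_vector_derivative
        ((r + cnj r) * (\<i> * of_real w * cis (w * t)) / \<i>
          - r * (cis (w * t) * (\<i> * of_real w * cis (w * t)) + \<i> * of_real w * cis (w * t) * cis (w * t)) / (2 * \<i>)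
          - cnj r * of_real w) / 2) (at t within S)"
      unfolding Q_def
      by (intro has_vector_derivative_divide has_vector_derivative_diff has_vector_derivative_mult_right
          has_vector_derivative_mult has_vector_derivative_of_real cis_deriv)
         (auto intro!: derivative_eq_intros)
    moreover have "((r + cnj r) * (\<i> * W * z) / \<i> - r * (z * (\<i> * W * z) + \<i> * W * z * z) / (2 * \<i>) - cnj r * W) / 2
        = W * (z * ((r * (1 - z) + cnj r * (1 - inverse z)) / 2))" if "z \<noteq> 0" for W z
      using that by (simp add: field_simps)
    ultimately show ?thesis
      unfolding stroke_eq by (simp only: cis_neq_zero not_False_eq_True simp_thms)
  qed
  show "(G has_vector_derivative gait r w t) (at t within S)" for t S
  proof -
    have "(G has_vector_derivative
       - (of_real m * (of_real d\<^sub>s * (direction * (cis (w * t) * of_real (stroke' r (w * t) * w)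
            + \<i> * of_real w * cis (w * t) * of_real (stroke r (w * t))))
        + of_real d\<^sub>d * (cnj direction * (cis (w * t) * of_real (stroke' r (w * t) * w)
            + \<i> * of_real w * cis (w * t) * of_real (stroke r (w * t))
            - 2 * \<i> * (of_real w * (cis (w * t) * of_real (stroke r (w * t)))))))))
       (at t within S)"
      unfolding G_def
      by (intro has_vector_derivative_minus has_vector_derivative_mult_right has_vector_derivative_add
          has_vector_derivative_diff has_vector_derivative_mult has_vector_derivative_of_real
          cis_deriv stroke_deriv' Q)
    also have "- (of_real m * (of_real d\<^sub>s * (direction * (cis (w * t) * of_real (stroke' r (w * t) * w)
            + \<i> * of_real w * cis (w * t) * of_real (stroke r (w * t))))
        + of_real d\<^sub>d * (cnj direction * (cis (w * t) * of_real (stroke' r (w * t) * w)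
            + \<i> * of_real w * cis (w * t) * of_real (stroke r (w * t))
            - 2 * \<i> * (of_real w * (cis (w * t) * of_real (stroke r (w * t)))))))) = gait r w t"
      unfolding gait_def thrust_def mobility_cis by (simp add: algebra_simps)
    finally show ?thesis .
  qed
  show "G T - G 0 = gait_gain * cnj r" if "w * T = 2 * pi" for T
  proof -
    have st: "stroke r (2 * pi) = 0" "stroke r 0 = 0" by (simp_all add: stroke_def)
    have "G T - G 0 = 2 * \<i> * (of_real (m * d\<^sub>d) * cnj direction) * (Q (2 * pi) - Q 0)"
      by (simp only: G_def that st mult_zero_right of_real_0) (simp add: algebra_simps)
    \<comment> \<open>The exponentials are periodic; only the linear term of \<open>Q\<close>
      changes over a turn.\<close>
    also have "Q (2 * pi) - Q 0 = - (of_real pi * cnj r)"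
      by (simp add: Q_def diff_divide_distrib)
    finally show ?thesis by (simp add: gait_gain_def)
  qed
qed

text \<open>The thrust is of order \<open>1 / T\<close> and its effect over a turn of order 1,
  whereas the circulation has only time \<open>T\<close> to act and alters the displacement by a
  term of order \<open>T\<close>.\<close>

lemma gait_response:
  assumes T: "0 < T" "rate * T \<le> 1 / 2"
  obtains v where "v 0 = 0"
    and "\<And>t. t \<in> {0..T} \<Longrightarrow> (v has_vector_derivative
          coriolis (2 * pi / T * t) (v t) + gait r (2 * pi / T) t) (at t within {0..T})"
    and "norm (v T - gait_gain * cnj r) \<le> 2 * rate * gait_bound * T * norm r"
proof -
  let ?w = "2 * pi / T"
  have "0 \<in> {0..T}" "rate * T < 1" using T by auto
  moreover have "continuous_on {0..T} (\<lambda>t. ?w * t)" by (intro continuous_intros)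
  ultimately obtain v where v: "v 0 = 0"
    "\<And>t. t \<in> {0..T} \<Longrightarrow> (v has_vector_derivative coriolis (?w * t) (v t) + gait r ?w t) (at t within {0..T})"
    by (rule drift_solution[where q = 0 and e = "gait r ?w", OF _ _ _ continuous_on_gait]) (rule that)
  obtain G where G: "\<And>t S. (G has_vector_derivative gait r ?w t) (at t within S)"
    and gain: "\<And>T. ?w * T = 2 * pi \<Longrightarrow> G T - G 0 = gait_gain * cnj r"
    by (rule gait_antiderivative[where r = r and w = ?w]) (rule that)
  have "norm ((v T - v 0) - (G T - G 0))
     \<le> 2 * rate * T * (norm (v 0) + T * (m * ((\<bar>d\<^sub>s\<bar> + \<bar>d\<^sub>d\<bar>) * (norm direction * (3 * norm r * ?w)))))"
  proof (rule linear_ode_displacement[where A = "\<lambda>t. coriolis (?w * t)" and e = "gait r ?w"])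
    show "norm (gait r ?w t) \<le> m * ((\<bar>d\<^sub>s\<bar> + \<bar>d\<^sub>d\<bar>) * (norm direction * (3 * norm r * ?w)))" for t
      using T by (intro norm_gait) simp
  qed (use T v(2) G norm_coriolis rate_nonneg in auto)
  also have "\<dots> = 2 * rate * gait_bound * T * norm r"
    using T v(1) by (simp add: gait_bound_def)
  finally have "norm (v T - gait_gain * cnj r) \<le> 2 * rate * gait_bound * T * norm r"
    using v(1) gain[of T] T by simp
  with v show thesis by (rule that)
qed

text \<open>By superposition the motion is the thrust-free motion \<open>q\<close> plus a real
  combination of the basic responses \<open>v\<^sub>1\<close> and \<open>v\<^sub>2\<close>. The
  radius does not depend on \<open>p\<^sub>0\<close>, although the duration may.\<close>

lemma reachable_nearby:
  assumes "norm (p\<^sub>1 - p\<^sub>0) < norm gait_gain / 8"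
  shows "reachable (state p\<^sub>0 0 0) (state p\<^sub>1 0 0)"
proof -
  define c where "c = norm gait_gain"
  have c: "0 < c" using gait_gain_nz by (simp add: c_def)
  define E where "E = (\<bar>d\<^sub>s\<bar> + \<bar>d\<^sub>d\<bar>) * (norm (Complex p\<^sub>x p\<^sub>y) + norm (Complex (chi B) (zeta B)))"
  have E: "0 \<le> E" by (simp add: E_def)
  have gb: "0 \<le> gait_bound" using m_pos by (simp add: gait_bound_def)
  \<comment> \<open>A bound on the speed of \<open>q\<close>, valid for
    \<open>T \<le> 1\<close>.\<close>
  define \<kappa> where "\<kappa> = rate * (2 * (norm p\<^sub>0 + E)) + E"
  have \<kappa>: "0 \<le> \<kappa>" using E rate_nonneg by (simp add: \<kappa>_def)
  \<comment> \<open>The summands make \<open>T = 1 / N\<close> short enough for, in turn,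
    \<open>T \<le> 1\<close>, the estimates for linear equations, a relative response error of at
    most \<open>c / 2\<close>, and a displacement of \<open>q\<close> of at most
    \<open>c / 8\<close>.\<close>
  define N where "N = 1 + 2 * rate + 8 * rate * gait_bound / c + 8 * \<kappa> / c"
  have N: "1 \<le> N" "2 * rate \<le> N" "8 * rate * gait_bound / c \<le> N" "8 * \<kappa> / c \<le> N"
    using rate_nonneg gb \<kappa> c by (auto simp: N_def)
  define T where "T = 1 / N"
  have T: "0 < T" "T \<le> 1" "rate * T \<le> 1 / 2" "4 * rate * gait_bound * T \<le> c / 2" "\<kappa> * T \<le> c / 8"
    using N c by (auto simp: T_def field_simps)
  let ?w = "2 * pi / T"
  have "0 \<in> {0..T}" "rate * T < 1" using T by auto
  moreover have "continuous_on {0..T} (\<lambda>t. ?w * t)" "continuous_on {0..T} (\<lambda>t. background (?w * t))"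
    by (intro continuous_intros)+
  ultimately obtain q where q: "q 0 = p\<^sub>0"
    "\<And>t. t \<in> {0..T} \<Longrightarrow>
      (q has_vector_derivative coriolis (?w * t) (q t) + background (?w * t)) (at t within {0..T})"
    by (rule drift_solution[where q = p\<^sub>0]) (rule that)
  obtain v\<^sub>1 where v1: "v\<^sub>1 0 = 0"
    "\<And>t. t \<in> {0..T} \<Longrightarrow> (v\<^sub>1 has_vector_derivative coriolis (?w * t) (v\<^sub>1 t) + gait 1 ?w t) (at t within {0..T})"
    "norm (v\<^sub>1 T - gait_gain * cnj 1) \<le> 2 * rate * gait_bound * T * norm (1::complex)"
    using gait_response[OF T(1,3)] by blast
  obtain v\<^sub>2 where v2: "v\<^sub>2 0 = 0"
    "\<And>t. t \<in> {0..T} \<Longrightarrow> (v\<^sub>2 has_vector_derivative coriolis (?w * t) (v\<^sub>2 t) + gait \<i> ?w t) (at t within {0..T})"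
    "norm (v\<^sub>2 T - gait_gain * cnj \<i>) \<le> 2 * rate * gait_bound * T * norm \<i>"
    using gait_response[OF T(1,3)] by blast
  have q_bound: "norm (q T - p\<^sub>0) \<le> c / 8"
  proof -
    have "norm (q T - q 0) \<le> \<kappa> * \<bar>T - 0\<bar>"
    proof (rule vector_mean_value_bound[OF q(2)])
      fix t assume t: "t \<in> {0..T}"
      have "norm (q t) \<le> 2 * (norm (q 0) + T * E)"
        using linear_ode_bound[of T q "\<lambda>t. coriolis (?w * t)" "\<lambda>t. background (?w * t)" rate E t]
          q(2) norm_coriolis norm_background rate_nonneg T t by (auto simp: E_def)
      also have "\<dots> \<le> 2 * (norm p\<^sub>0 + E)"
        using T E q(1) mult_right_mono[of T 1 E] by auto
      finally have "rate * norm (q t) \<le> rate * (2 * (norm p\<^sub>0 + E))"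
        using rate_nonneg by (rule mult_left_mono)
      then show "norm (coriolis (?w * t) (q t) + background (?w * t)) \<le> \<kappa>"
        unfolding \<kappa>_def using norm_coriolis[of "?w * t" "q t"] norm_background[of "?w * t"]
        by (intro norm_triangle_le) (simp add: E_def)
    qed (use T in auto)
    then show ?thesis using T q(1) by simp
  qed
  \<comment> \<open>The displacement due to the stroke. Each basic response errs by at most
    \<open>c / 4\<close>, which gives \<open>c / 2\<close> in total.\<close>
  define f where "f = (\<lambda>r. Re r *\<^sub>R v\<^sub>1 T + Im r *\<^sub>R v\<^sub>2 T)"
  have "linear f" by (rule linearI) (simp_all add: f_def algebra_simps)
  moreover have "norm (f r - gait_gain * cnj r) \<le> c / 2 * norm r" for r
  proof -
    have "cnj r = Re r *\<^sub>R cnj 1 + Im r *\<^sub>R cnj \<i>" by (simp add: complex_eq_iff)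
    then have "f r - gait_gain * cnj r
        = Re r *\<^sub>R (v\<^sub>1 T - gait_gain * cnj 1) + Im r *\<^sub>R (v\<^sub>2 T - gait_gain * cnj \<i>)"
      by (simp only: f_def) (simp add: algebra_simps scaleR_conv_of_real)
    also have "norm \<dots> \<le> \<bar>Re r\<bar> * norm (v\<^sub>1 T - gait_gain * cnj 1) + \<bar>Im r\<bar> * norm (v\<^sub>2 T - gait_gain * cnj \<i>)"
      by (rule order_trans[OF norm_triangle_ineq]) simp
    also have "\<dots> \<le> norm r * (2 * rate * gait_bound * T) + norm r * (2 * rate * gait_bound * T)"
      using v1(3) v2(3) abs_Re_le_cmod[of r] abs_Im_le_cmod[of r] by (intro add_mono mult_mono) auto
    also have "\<dots> = 4 * rate * gait_bound * T * norm r" by simp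
    also have "\<dots> \<le> c / 2 * norm r" using T(4) by (rule mult_right_mono) simp
    finally show ?thesis .
  qed
  ultimately obtain r where r: "f r = p\<^sub>1 - q T" "(c - c / 2) * norm r \<le> norm (p\<^sub>1 - q T)"
    using real_linear_near_cnj_surj[of f "c / 2" gait_gain "p\<^sub>1 - q T"] c unfolding c_def by auto
  \<comment> \<open>The hypothesis and the displacement of \<open>q\<close> contribute
    \<open>c / 8\<close> each. Hence \<open>norm r < 1 / 2\<close>, which keeps the stroke strictly
    between -1 and 1, where \<open>arcsin\<close> is differentiable.\<close>
  have "norm (p\<^sub>1 - q T) < c / 4"
    using assms q_bound norm_triangle_ineq4[of "p\<^sub>1 - p\<^sub>0" "q T - p\<^sub>0"] by (simp add: c_def)
  with r(2) have "c / 2 * norm r < c / 2 * (1 / 2)" by simp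
  then have r_small: "norm r < 1 / 2" using c by (simp only: mult_less_cancel_left_pos half_gt_zero)
  have stroke_small: "- 1 < stroke r \<alpha>" "stroke r \<alpha> < 1" for \<alpha>
    using abs_stroke(1)[of r \<alpha>] r_small by auto
  then have root_pos: "0 < sqrt (1 - (stroke r \<alpha>)\<^sup>2)" for \<alpha>
    by (simp add: abs_square_less_1 abs_less_iff minus_less_iff)
  \<comment> \<open>Inverts \<open>u = sin s\<close> on the branch with positive
    \<open>cos s\<close>.\<close>
  define s where "s = (\<lambda>t. arcsin (stroke r (?w * t)))"
  define s' where "s' = (\<lambda>t. stroke' r (?w * t) * ?w / sqrt (1 - (stroke r (?w * t))\<^sup>2))"
  have sin_s: "sin (s t) = stroke r (?w * t)" for t
    using stroke_small[of "?w * t"] by (simp add: s_def)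
  have cos_s: "cos (s t) * s' t = stroke' r (?w * t) * ?w" for t
    using stroke_small[of "?w * t"] root_pos[of "?w * t"] by (simp add: s_def s'_def cos_arcsin)
  define p where "p = (\<lambda>t. q t + (Re r *\<^sub>R v\<^sub>1 t + Im r *\<^sub>R v\<^sub>2 t))"
  have "reachable (state (p 0) (?w * 0) (s 0)) (state (p T) (?w * T) (s T))"
  proof (rule reachable_of_shape_path)
    show "((\<lambda>t. ?w * t) has_real_derivative ?w) (at t within {0..T})" for t
      using T by (auto intro!: derivative_eq_intros)
    show "(s has_real_derivative s' t) (at t within {0..T})" for t
    proof -
      have "((\<lambda>t. stroke r (?w * t)) has_real_derivative stroke' r (?w * t) * ?w) (at t within {0..T})"
        using T by (intro DERIV_chain2[OF stroke_deriv]) (auto intro!: derivative_eq_intros)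
      from DERIV_chain2[OF DERIV_arcsin[OF stroke_small] this]
      show ?thesis by (simp add: s_def s'_def field_simps)
    qed
    show "continuous_on {0..T} s'"
      unfolding s'_def using root_pos by (intro continuous_intros) (auto simp: less_imp_neq[symmetric])
    fix t assume t: "t \<in> {0..T}"
    have "(p has_vector_derivative (coriolis (?w * t) (q t) + background (?w * t))
        + (Re r *\<^sub>R (coriolis (?w * t) (v\<^sub>1 t) + gait 1 ?w t)
          + Im r *\<^sub>R (coriolis (?w * t) (v\<^sub>2 t) + gait \<i> ?w t))) (at t within {0..T})"
      unfolding p_def
      by (intro has_vector_derivative_add q(2)[OF t]
          bounded_linear.has_vector_derivative[OF bounded_linear_scaleR_right] v1(2)[OF t] v2(2)[OF t])
    also have "(coriolis (?w * t) (q t) + background (?w * t))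
        + (Re r *\<^sub>R (coriolis (?w * t) (v\<^sub>1 t) + gait 1 ?w t)
          + Im r *\<^sub>R (coriolis (?w * t) (v\<^sub>2 t) + gait \<i> ?w t))
      = coriolis (?w * t) (p t) + (background (?w * t) + gait r ?w t)"
      unfolding gait_linear[of r] p_def coriolis_add coriolis_scaleR by (simp add: scaleR_add_right)
    also have "\<dots> = velocity (?w * t) (s t) ?w (s' t) (p t)"
      unfolding velocity_eq sin_s cos_s gait_def by (rule refl)
    finally show "(p has_vector_derivative velocity (?w * t) (s t) ?w (s' t) (p t)) (at t within {0..T})" .
  qed (use T in auto)
  moreover have "p 0 = p\<^sub>0" using q(1) v1(1) v2(1) by (simp add: p_def)
  moreover have "p T = p\<^sub>1" using r(1) by (simp add: p_def f_def)
  \<comment> \<open>The angle \<open>2 * pi\<close> is the same point of the circle as 0, and the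
    stroke vanishes there again, so that \<open>s T = 0\<close>.\<close>
  moreover have "?w * T = 2 * pi" using T by simp
  ultimately show ?thesis
    by (simp add: s_def stroke_def)
qed

text \<open>The points of a small ball are reachable from one another in both orders, so
  transitivity and the connectedness of the plane suffice, without reversing any motion.\<close>

lemma reachable_at_rest: "reachable (state p\<^sub>0 0 0) (state p\<^sub>1 0 0)"
proof (rule connected_equivalence_relation_gen[where S = UNIV and P = "\<lambda>_. True"
      and R = "\<lambda>p q. reachable (state p 0 0) (state q 0 0)"])
  fix a :: complex
  \<comment> \<open>Two points of this ball are closer than its diameter, the distance allowed by
    \<open>reachable_nearby\<close>.\<close>
  let ?U = "ball a (norm gait_gain / 16)"
  have near: "reachable (state p 0 0) (state q 0 0)" if "p \<in> ?U" "q \<in> ?U" for p q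
  proof (rule reachable_nearby)
    show "norm (q - p) < norm gait_gain / 8"
      using dist_triangle_half_r[of a p "norm gait_gain / 8" q] that
      by (simp add: dist_norm norm_minus_commute)
  qed
  have "a \<in> ?U" using gait_gain_nz by simp
  then show "\<exists>T. openin (top_of_set UNIV) T \<and> a \<in> T \<and>
      (\<forall>x\<in>T. \<forall>y\<in>T. True \<and> True \<longrightarrow> reachable (state x 0 0) (state y 0 0))"
    by (intro exI[of _ ?U] conjI ballI impI near) (simp_all only: subtopology_UNIV open_openin[symmetric] open_ball)
qed (use reachable_trans in auto)

text \<open>Three stages: bring both angles to 0, arriving at some position; change the position;
  finish with a motion chosen by its end point, which starts from zero angles at a position that the
  second stage can reach.\<close>

lemma reachable_extended_space:
  assumes "e\<^sub>0 \<in> extended_space" "e\<^sub>1 \<in> extended_space"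
  shows "reachable e\<^sub>0 e\<^sub>1"
proof -
  have cis: "\<exists>p \<alpha> s. e = state p \<alpha> s" if "e \<in> extended_space" for e
  proof -
    obtain x y u v where e: "e = (x, y, u, v)" by (cases e)
    then have "norm u = 1" "norm v = 1" using that by (auto simp: extended_space_def)
    moreover have "cis (Arg z) = z" if "norm z = 1" for z
      using that cis_Arg[of z] by (cases "z = 0") (auto simp: sgn_eq)
    ultimately have "cis (Arg u) = u" "cis (Arg v) = v" by auto
    then show ?thesis
      unfolding e by (intro exI[of _ "Complex x y"] exI[of _ "Arg u"] exI[of _ "Arg v"]) simp
  qed
  obtain p\<^sub>0 \<alpha>\<^sub>0 s\<^sub>0 p\<^sub>1 \<alpha>\<^sub>1 s\<^sub>1 where e: "e\<^sub>0 = state p\<^sub>0 \<alpha>\<^sub>0 s\<^sub>0" "e\<^sub>1 = state p\<^sub>1 \<alpha>\<^sub>1 s\<^sub>1"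
    using cis assms by meson
  obtain q\<^sub>0 where "reachable e\<^sub>0 (state q\<^sub>0 0 0)"
    unfolding e using reachable_shape_from by blast
  moreover obtain q\<^sub>1 where "reachable (state q\<^sub>1 0 0) e\<^sub>1"
    unfolding e using reachable_shape_to by blast
  ultimately show ?thesis using reachable_at_rest reachable_trans by blast
qed

end

theorem theorem3p2:
  fixes B :: swimmer
    and k\<^sub>1 k\<^sub>2 p\<^sub>x p\<^sub>y K :: real
    and \<xi> \<eta> :: "real \<Rightarrow> real"
    and z\<^sub>0 z\<^sub>1 :: "real \<times> real \<times> complex \<times> complex"
  assumes "admissible_swimmer B"
    and "\<not> (k\<^sub>1 = 0 \<and> k\<^sub>2 = 0)"
    and "\<xi> = (\<lambda>s. k\<^sub>1 * sin s)"
    and "\<eta> = (\<lambda>s. k\<^sub>2 * sin s)"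
    and "z\<^sub>0 \<in> extended_space"
    and "z\<^sub>1 \<in> extended_space"
  shows "\<exists>T \<sigma>\<^sub>1 \<Omega> z. T \<ge> 0 \<and>
           piecewise_continuous_on 0 T \<sigma>\<^sub>1 \<and> piecewise_continuous_on 0 T \<Omega> \<and>
           is_solution B \<xi> \<eta> p\<^sub>x p\<^sub>y K T \<sigma>\<^sub>1 \<Omega> z \<and>
           extended_point (z 0) = z\<^sub>0 \<and> extended_point (z T) = z\<^sub>1"
proof -
  interpret straight_swimmer B k\<^sub>1 k\<^sub>2 p\<^sub>x p\<^sub>y K
    using assms(1,2) by unfold_locales
  show ?thesis
    using reachable_extended_space[OF assms(5,6)] unfolding reachable_def assms(3,4) .
qed

end
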